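(* Let $L/K$ be a finite totally ramified separable extension of degree $n=up^{\nu}$ with $p\nmid u$, where $K$ is complete with respect to a discrete valuation and has perfect residue field of characteristic $p$. For $0\le m\le\nu$ write the $m$th index of inseparability of $L/K$ in the form $i_m=A_mn-b_m$ with $A_m, b_m$ integers and $1\le b_m\le n$. Let $\pi_L$, $\tilde{\pi}_L$ be uniformizers for $L$, with minimum polynomials over $K$ \[f(X)=X^n-c_1X^{n-1}+\cdots+(-1)^{n-1}c_{n-1}X+(-1)^nc_n,\] \[\tilde{f}(X)=X^n-\tilde{c}_1X^{n-1}+\cdots+(-1)^{n-1}\tilde{c}_{n-1}X+(-1)^n\tilde{c}_n\] respectively, such that there are an integer $\ell\ge1$, $r\in\mathcal{O}_K$, and $\sigma\in\mathrm{Aut}_K(L)$ with \[\sigma(\tilde{\pi}_L)\equiv\pi_L+r\pi_L^{\ell+1}\pmod{\mathcal{M}_L^{\ell+2}}.\] Let $0\le j\le\nu$ satisfy $\overline{v}_p(\phi_j(\ell))=j$, and let $h$ be the unique integer such that $1\le h\le n$ and $n$ divides $\phi_j(\ell)+h$. Set $k=(\phi_j(\ell)+h)/n$ and $h_0=h/p^j$. Then \[\tilde{c}_h\equiv c_h+\sum_{m\in S_j}g_m\,c_n^{k-A_m}c_{b_m}r^{p^m}\pmod{\mathcal{M}_K^{k+1}},\] where \[S_j=\{m:0\le m\le j,\ \phi_j(\ell)=\tilde{\phi}_m(\ell)\}\] and \[g_m=\begin{cases} (-1)^{k+\ell+A_m}(h_0p^{j-m}+\ell-up^{\nu-m})&\text{if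 }b_m<h,\\ (-1)^{k+\ell+A_m}(h_0p^{j-m}+\ell)&\text{if }h\le b_m<n,\\ (-1)^{k+\ell+A_m}up^{\nu-m}&\text{if }b_m=n. \end{cases}\]
   Context: $K$ is a field complete with respect to a discrete valuation $v_K$ (normalized so that a uniformizer of $K$ has valuation 1), with ring of integers $\mathcal{O}_K$ and maximal ideal $\mathcal{M}_K$; its residue field $\mathcal{O}_K/\mathcal{M}_K$ is perfect of characteristic $p$. $L/K$ is a finite totally ramified subextension of a separable closure of $K$, of degree $n=up^{\nu}$ with $p\nmid u$; $v_L$ is the normalized valuation of $L$, $\mathcal{M}_L$ the maximal ideal of its ring of integers, and $e_L=v_L(p)$ (so $e_L=\infty$ if $\mathrm{char}(K)=p$). $\mathrm{Aut}_K(L)$ is the group of $K$-automorphisms of $L$. For $k\in\mathbb{Z}$ set $\overline{v}_p(k)=\min\{v_p(k),\nu\}$, where $v_p$ is the $p$-adic valuation on integers. Indices of inseparability: let $\pi_L$ be a uniformizer for $L$ with minimum polynomial $X^n-c_1X^{n-1}+\cdots+(-1)^nc_n$ over $K$. For $0\le j\le\nu$ set \[i_j^{\pi_L}=\min\{nv_K(c_h)-h:1\le h\le n,\ \overline{v}_p(h)\le j\}\] (a nonnegative integer or $\infty$, with $v_K(0)=\infty$), and define the $j$th index of inseparability of $L/K$ to be \[i_j=\min\{i_{j'}^{\pi_L}+(j'-j)e_L:j\le j'\le\nu\},\] with the convention $0\cdot\infty=0$ (so $i_j=i_j^{\pi_L}$ if $\mathrm{char}(K)=p$). It is known that $i_j$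 is finite and does not depend on the choice of $\pi_L$. Generalized Hasse-Herbrand functions: for $0\le j\le\nu$ and real $x\ge0$ set $\tilde{\phi}_j(x)=i_j+p^jx$ and \[\phi_j(x)=\min\{\tilde{\phi}_{j_0}(x):0\le j_0\le j\}.\] *)

theory Defs
  imports
    "HOL-Library.Extended_Real"
    "HOL-Computational_Algebra.Computational_Algebra"
begin

section \<open>Complete discretely valued fields\<close>

definition normalized_discrete_valuation :: "('a::field \<Rightarrow> ereal) \<Rightarrow> bool" where
  "normalized_discrete_valuation v \<longleftrightarrow>
     (\<forall>x. v x = \<infinity> \<longleftrightarrow> x = 0) \<and>
     (\<forall>x. x \<noteq> 0 \<longrightarrow> (\<exists>z::int. v x = ereal (of_int z))) \<and>
     (\<forall>x y. v (x * y) = v x + v y) \<and>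
     (\<forall>x y. min (v x) (v y) \<le> v (x + y)) \<and>
     (\<exists>x. v x = 1)"

definition valuation_ring :: "('a::field \<Rightarrow> ereal) \<Rightarrow> 'a set" where
  "valuation_ring v = {x. 0 \<le> v x}"

text \<open>The (possibly fractional) power \<open>\<M>\<^sup>t\<close> of the maximal ideal \<open>\<M> = max_ideal_pow v 1\<close>.\<close>

definition max_ideal_pow :: "('a::field \<Rightarrow> ereal) \<Rightarrow> int \<Rightarrow> 'a set" where
  "max_ideal_pow v t = {x. ereal (of_int t) \<le> v x}"

definition cong_mod :: "'a::field \<Rightarrow> 'a \<Rightarrow> 'a set \<Rightarrow> bool" where
  "cong_mod x y I \<longleftrightarrow> x - y \<in> I"

definition uniformizer :: "('a::field \<Rightarrow> ereal) \<Rightarrow> 'a \<Rightarrow> bool" where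
  "uniformizer v x \<longleftrightarrow> v x = 1"

definition valuation_complete :: "('a::field \<Rightarrow> ereal) \<Rightarrow> bool" where
  "valuation_complete v \<longleftrightarrow>
     (\<forall>s::nat \<Rightarrow> 'a.
        (\<forall>t::int. \<exists>N. \<forall>a\<ge>N. \<forall>b\<ge>N. cong_mod (s a) (s b) (max_ideal_pow v t)) \<longrightarrow>
        (\<exists>x. \<forall>t::int. \<exists>N. \<forall>a\<ge>N. cong_mod (s a) x (max_ideal_pow v t)))"

text \<open>The residue field has characteristic \<open>p\<close>, and its Frobenius map is onto.\<close>

definition perfect_residue_field :: "('a::field \<Rightarrow> ereal) \<Rightarrow> nat \<Rightarrow> bool" where
  "perfect_residue_field v p \<longleftrightarrow>
     prime p \<and> of_nat p \<in> max_ideal_pow v 1 \<and>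
     (\<forall>x\<in>valuation_ring v. \<exists>y\<in>valuation_ring v. cong_mod x (y ^ p) (max_ideal_pow v 1))"

section \<open>Field extensions, given by an embedding of the base field\<close>

definition field_embedding :: "('k::field \<Rightarrow> 'l::field) \<Rightarrow> bool" where
  "field_embedding \<iota> \<longleftrightarrow>
     \<iota> 1 = 1 \<and> (\<forall>x y. \<iota> (x + y) = \<iota> x + \<iota> y) \<and> (\<forall>x y. \<iota> (x * y) = \<iota> x * \<iota> y)"

text \<open>An infinite degree comes out as \<open>0\<close>.\<close>

definition field_degree :: "('k::field \<Rightarrow> 'l::field) \<Rightarrow> nat" where
  "field_degree \<iota> = vector_space.dim (\<lambda>a x. \<iota> a * x) (UNIV :: 'l set)"

definition is_min_poly :: "('k::field \<Rightarrow> 'l::field) \<Rightarrow> 'l \<Rightarrow> 'k poly \<Rightarrow> bool" where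
  "is_min_poly \<iota> x f \<longleftrightarrow>
     lead_coeff f = 1 \<and> poly (map_poly \<iota> f) x = 0 \<and>
     (\<forall>g. g \<noteq> 0 \<and> poly (map_poly \<iota> g) x = 0 \<longrightarrow> degree f \<le> degree g)"

definition min_poly :: "('k::field \<Rightarrow> 'l::field) \<Rightarrow> 'l \<Rightarrow> 'k poly" where
  "min_poly \<iota> x = (THE f. is_min_poly \<iota> x f)"

definition separable_extension :: "('k::field \<Rightarrow> 'l::field) \<Rightarrow> bool" where
  "separable_extension \<iota> \<longleftrightarrow>
     (\<forall>x. \<exists>f. is_min_poly \<iota> x f \<and> coprime f (pderiv f))"

definition field_Aut :: "('k::field \<Rightarrow> 'l::field) \<Rightarrow> ('l \<Rightarrow> 'l) set" where
  "field_Aut \<iota> = {\<sigma>. bij \<sigma> \<and> field_embedding \<sigma> \<and> (\<forall>a. \<sigma> (\<iota> a) = \<iota> a)}"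

text \<open>The ramification index, i.e. the factor by which \<open>v\<^sub>L\<close> scales \<open>v\<^sub>K\<close>, is the degree.\<close>

definition totally_ramified ::
  "('k::field \<Rightarrow> ereal) \<Rightarrow> ('l::field \<Rightarrow> ereal) \<Rightarrow> ('k \<Rightarrow> 'l) \<Rightarrow> bool" where
  "totally_ramified vK vL \<iota> \<longleftrightarrow> (\<forall>a. vL (\<iota> a) = ereal (real (field_degree \<iota>)) * vK a)"

text \<open>
  The elements \<open>c\<^sub>h\<close> with
  \<open>min_poly \<iota> x = X\<^sup>n - c\<^sub>1 X\<^sup>n\<^sup>-\<^sup>1 + \<dots> + (-1)\<^sup>n c\<^sub>n\<close>, where \<open>n\<close> is its degree.
\<close>

definition min_poly_coeff :: "('k::field \<Rightarrow> 'l::field) \<Rightarrow> 'l \<Rightarrow> nat \<Rightarrow> 'k" where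
  "min_poly_coeff \<iota> x h = (-1) ^ h * coeff (min_poly \<iota> x) (degree (min_poly \<iota> x) - h)"

section \<open>Indices of inseparability and generalized Hasse-Herbrand functions\<close>

text \<open>\<open>v\<^sub>p(0) = \<infinity>\<close>, whereas \<open>multiplicity p 0 = 0\<close>.\<close>

definition trunc_val :: "nat \<Rightarrow> nat \<Rightarrow> int \<Rightarrow> nat" where
  "trunc_val p \<nu> k = (if k = 0 then \<nu> else min (multiplicity (int p) k) \<nu>)"

definition insep_index_pre ::
  "('k::field \<Rightarrow> ereal) \<Rightarrow> ('k \<Rightarrow> 'l::field) \<Rightarrow> nat \<Rightarrow> nat \<Rightarrow> 'l \<Rightarrow> nat \<Rightarrow> ereal" where
  "insep_index_pre vK \<iota> p \<nu> \<pi> j =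
     Min {ereal (real (field_degree \<iota>)) * vK (min_poly_coeff \<iota> \<pi> h) - ereal (real h) | h.
          1 \<le> h \<and> h \<le> field_degree \<iota> \<and> trunc_val p \<nu> (int h) \<le> j}"

text \<open>In \<^typ>\<open>ereal\<close> the convention \<open>0 * \<infinity> = 0\<close> holds.\<close>

definition insep_index_at ::
  "('k::field \<Rightarrow> ereal) \<Rightarrow> ('l::field \<Rightarrow> ereal) \<Rightarrow> ('k \<Rightarrow> 'l) \<Rightarrow> nat \<Rightarrow> nat \<Rightarrow> 'l \<Rightarrow> nat \<Rightarrow> ereal" where
  "insep_index_at vK vL \<iota> p \<nu> \<pi> j =
     (MIN j'\<in>{j..\<nu>}. insep_index_pre vK \<iota> p \<nu> \<pi> j' + ereal (real (j' - j)) * vL (of_nat p))"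

text \<open>The value does not depend on the uniformizer that is used to compute it.\<close>

definition insep_index ::
  "('k::field \<Rightarrow> ereal) \<Rightarrow> ('l::field \<Rightarrow> ereal) \<Rightarrow> ('k \<Rightarrow> 'l) \<Rightarrow> nat \<Rightarrow> nat \<Rightarrow> nat \<Rightarrow> ereal" where
  "insep_index vK vL \<iota> p \<nu> j = insep_index_at vK vL \<iota> p \<nu> (SOME \<pi>. uniformizer vL \<pi>) j"

definition HH_tilde ::
  "('k::field \<Rightarrow> ereal) \<Rightarrow> ('l::field \<Rightarrow> ereal) \<Rightarrow> ('k \<Rightarrow> 'l) \<Rightarrow> nat \<Rightarrow> nat \<Rightarrow> nat \<Rightarrow> real \<Rightarrow> ereal" where
  "HH_tilde vK vL \<iota> p \<nu> j x = insep_index vK vL \<iota> p \<nu> j + ereal (real p ^ j * x)"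

definition HH ::
  "('k::field \<Rightarrow> ereal) \<Rightarrow> ('l::field \<Rightarrow> ereal) \<Rightarrow> ('k \<Rightarrow> 'l) \<Rightarrow> nat \<Rightarrow> nat \<Rightarrow> nat \<Rightarrow> real \<Rightarrow> ereal" where
  "HH vK vL \<iota> p \<nu> j x = (MIN j\<^sub>0\<in>{0..j}. HH_tilde vK vL \<iota> p \<nu> j\<^sub>0 x)"

end

theory Submission
  imports Defs
begin

text \<open>
  Since \<open>\<sigma>\<close> fixes the base field, \<open>\<sigma> \<pi>'\<close> and \<open>\<pi>'\<close> have the same minimal polynomial, so let \<open>\<sigma>\<close> be the
  identity. Let \<open>f\<close> be the minimal polynomial of \<open>\<pi>\<close>, let \<open>\<psi> = X + r X\<^sup>l\<^sup>+\<^sup>1\<close>, and suppose first that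
  \<open>\<pi>' = \<psi>(\<pi>)\<close>, with minimal polynomial \<open>f1\<close>. Then \<open>f\<close> divides \<open>f1 \<circ> \<psi>\<close>, and for \<open>D = f1 - f\<close>, which
  has degree less than \<open>n\<close>, this reads
  \<open>D = - (f \<circ> \<psi> - f) - (D \<circ> \<psi> - D)\<close> modulo \<open>f\<close>.
  This is a statement about polynomials over the base field alone. A monomial \<open>x X\<^sup>t\<close> is given the
  weight \<open>n v\<^sub>K(x) + t\<close>, and a polynomial is called above the threshold if each of its monomials has
  weight at least \<open>n + \<phi>\<^sub>q(l)\<close>, where \<open>q\<close> is the \<open>p\<close>-adic valuation of the exponent \<open>t\<close>, truncated at \<open>\<nu>\<close>.

  These thresholds fit the three operations involved. The binomial expansion of \<open>f \<circ> \<psi> - f\<close> is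
  above the threshold, by the definition of the indices of inseparability and because
  \<open>v\<^sub>p(t choose s) \<ge> v\<^sub>p(t) - v\<^sub>p(s)\<close>. Substituting \<open>\<psi>\<close> for \<open>X\<close> changes a polynomial by terms one
  step higher than itself. Reduction modulo \<open>f\<close> preserves the threshold and agrees, up to terms one
  step higher, with reduction modulo \<open>X\<^sup>n + f(0)\<close>. Hence \<open>D\<close> is above the threshold, and one
  step further it is the negative of \<open>f \<circ> \<psi> - f\<close>, reduced modulo \<open>X\<^sup>n + f(0)\<close>
  (\<open>above_perturbation\<close>). For the coefficient of \<open>X\<^sup>n\<^sup>-\<^sup>h\<close> only the terms of \<open>f \<circ> \<psi> - f\<close> of weight
  exactly \<open>n + \<phi>\<^sub>j(l)\<close> count. They come from the \<open>p\<^sup>m\<close>-th binomial terms of the monomials with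
  coefficient \<open>c\<^sub>b\<close>, \<open>b = b\<^sub>m\<close>, for \<open>m\<close> in \<open>S\<close> (\<open>perturbation_coeff\<close>); for \<open>b = n\<close> this is the
  leading monomial, and \<open>c\<^sub>n\<close> enters through the reduction. Finally
  \<open>(a p\<^sup>m choose p\<^sup>m)\<close> is congruent to \<open>a\<close> modulo \<open>p a\<close>, and \<open>n / p\<^sup>m\<close> times \<open>c\<^sub>b\<close> is negligible for
  \<open>b < n\<close>, so that both the binomial coefficient of each term and \<open>g\<^sub>m\<close> amount to \<open>b\<^sub>m / p\<^sup>m\<close>, with the same
  sign after all signs are collected (\<open>leading_term_value\<close>).

  In general \<open>\<pi>'\<close> is reached from \<open>\<psi>(\<pi>)\<close> by further substitutions of the same kind with larger \<open>l\<close>,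
  up to an error of high valuation. Their effect is above the threshold for \<open>l + 1\<close>, and does not
  matter (\<open>above_min_poly_diff\<close>). The same chain of substitutions shows that the coefficients for any
  uniformizer obey the bounds given by the indices of inseparability, which are computed from one
  particular uniformizer (\<open>admissible_any_uniformizer\<close>).
\<close>

section \<open>Discrete valuations through integral thresholds\<close>

text \<open>
  A normalized discrete valuation \<open>v\<close>, rescaled by a positive integer \<open>n\<close>. For the base field \<open>n\<close> is
  the degree of the extension, so that \<open>n v\<close> is the restriction of the valuation of the extension
  field; for the extension field itself \<open>n = 1\<close>.
\<close>

locale scaled_valuation =
  fixes v :: "'a::field \<Rightarrow> ereal" and n :: nat
  assumes val: "normalized_discrete_valuation v" and n_pos: "0 < n"
begin

text \<open>
  \<open>val_ge T x\<close> says \<open>n v(x) \<ge> T\<close>. Thresholds are integers, which keeps the infinite value of \<open>v\<close> at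
  \<open>0\<close> out of all later calculations.
\<close>

definition val_ge :: "int \<Rightarrow> 'a \<Rightarrow> bool" where
  "val_ge T x \<longleftrightarrow> ereal (of_int T) \<le> ereal (real n) * v x"

lemma v_0 [simp]: "v 0 = \<infinity>"
  using val by (simp add: normalized_discrete_valuation_def)

lemma v_nonzero: "x \<noteq> 0 \<Longrightarrow> \<exists>z::int. v x = ereal (of_int z)"
  using val by (simp add: normalized_discrete_valuation_def)

lemma v_mult: "v (x * y) = v x + v y"
  using val by (simp add: normalized_discrete_valuation_def)

lemma v_add: "min (v x) (v y) \<le> v (x + y)"
  using val by (simp add: normalized_discrete_valuation_def)

lemma v_1 [simp]: "v 1 = 0"
proof -
  obtain z :: int where z: "v 1 = ereal (of_int z)" using v_nonzero[of 1] by auto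
  have "v (1 * 1) = v 1 + v 1" by (rule v_mult)
  thus ?thesis by (simp add: z)
qed

lemma v_uminus [simp]: "v (- x) = v x"
proof -
  obtain z :: int where z: "v (-1) = ereal (of_int z)" using v_nonzero[of "-1"] by auto
  have "v ((-1) * (-1)) = v (-1) + v (-1)" by (rule v_mult)
  hence "v (-1) = 0" by (simp add: z zero_ereal_def)
  moreover have "v ((-1) * x) = v (-1) + v x" by (rule v_mult)
  ultimately show ?thesis by simp
qed

lemma val_ge_iff: "val_ge T x \<longleftrightarrow> x = 0 \<or> (\<exists>z::int. v x = ereal (of_int z) \<and> T \<le> int n * z)"
proof (cases "x = 0")
  case True
  thus ?thesis using n_pos by (simp add: val_ge_def)
next
  case False
  then obtain z :: int where z: "v x = ereal (of_int z)" using v_nonzero by blast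
  have "val_ge T x \<longleftrightarrow> real_of_int T \<le> real_of_int (int n * z)" by (simp add: val_ge_def z)
  also have "\<dots> \<longleftrightarrow> T \<le> int n * z" by (rule of_int_le_iff)
  finally show ?thesis using False z by auto
qed

lemma val_ge_0 [simp]: "val_ge T 0" by (simp add: val_ge_iff)

lemma val_ge_mono: "val_ge T x \<Longrightarrow> S \<le> T \<Longrightarrow> val_ge S x"
  by (auto simp: val_ge_iff)

lemma val_ge_uminus [simp]: "val_ge T (- x) \<longleftrightarrow> val_ge T x"
  by (simp add: val_ge_def)

lemma val_ge_add: assumes "val_ge T x" "val_ge T y" shows "val_ge T (x + y)"
proof -
  have "ereal (real n) * min (v x) (v y) \<le> ereal (real n) * v (x + y)"
    by (intro ereal_mult_left_mono v_add) simp
  thus ?thesis using assms by (auto simp: val_ge_def min_def split: if_splits)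
qed

lemma val_ge_diff: "val_ge T x \<Longrightarrow> val_ge T y \<Longrightarrow> val_ge T (x - y)"
  using val_ge_add[of T x "- y"] by simp

lemma val_ge_sum: "(\<And>i. i \<in> A \<Longrightarrow> val_ge T (f i)) \<Longrightarrow> val_ge T (sum f A)"
  by (induction A rule: infinite_finite_induct) (auto intro: val_ge_add)

lemma val_ge_mult: "val_ge S x \<Longrightarrow> val_ge T y \<Longrightarrow> val_ge (S + T) (x * y)"
proof (cases "x = 0 \<or> y = 0")
  case False
  assume "val_ge S x" "val_ge T y"
  with False obtain z w :: int where "v x = ereal (of_int z)" "S \<le> int n * z"
      "v y = ereal (of_int w)" "T \<le> int n * w"
    by (auto simp: val_ge_iff)
  hence "v (x * y) = ereal (of_int (z + w))" "S + T \<le> int n * (z + w)"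
    by (simp_all add: v_mult distrib_left)
  thus ?thesis unfolding val_ge_iff by blast
qed auto

lemma val_ge_1 [simp]: "val_ge 0 1"
  unfolding val_ge_def by simp

lemma val_ge_power: "val_ge S x \<Longrightarrow> val_ge (int i * S) (x ^ i)"
proof (induction i)
  case (Suc i)
  from val_ge_mult[OF Suc.prems Suc.IH[OF Suc.prems]] show ?case by (simp add: algebra_simps)
qed simp

lemma val_ge_power_0: "val_ge 0 x \<Longrightarrow> val_ge 0 (x ^ i)"
  using val_ge_power[of 0 x i] by simp

lemma val_ge_mult_int: "val_ge S x \<Longrightarrow> val_ge 0 y \<Longrightarrow> val_ge S (x * y)"
  using val_ge_mult[of S x 0 y] by simp

lemma val_ge_of_nat [simp]: "val_ge 0 (of_nat i)"
  by (induction i) (auto intro: val_ge_add)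

lemma val_ge_of_int [simp]: "val_ge 0 (of_int i)"
  by (cases i) (auto intro: val_ge_diff simp del: of_nat_Suc)

lemma val_ge_of_nat_dvd:
  assumes "val_ge T (of_nat a)" "a dvd b" shows "val_ge T (of_nat b)"
proof -
  from assms(2) obtain d where "b = a * d" by blast
  thus ?thesis using val_ge_mult[OF assms(1) val_ge_of_nat[of d]] by simp
qed

text \<open>
  The values of \<open>n v\<close> are multiples of \<open>n\<close>; hence a bound that is not a multiple of \<open>n\<close> improves for
  free, as in this and the next lemma.
\<close>

lemma val_ge_succ: "val_ge T x \<Longrightarrow> \<not> int n dvd T \<Longrightarrow> val_ge (T + 1) x"
  unfolding val_ge_iff by (metis dvd_triv_left order_le_less zless_imp_add1_zle)

lemma val_ge_round_up:
  assumes "val_ge (int n * k + 1) x" shows "val_ge (int n * (k + 1)) x"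
proof (cases "x = 0")
  case False
  with assms obtain z :: int where z: "v x = ereal (of_int z)" "int n * k + 1 \<le> int n * z"
    by (auto simp: val_ge_iff)
  hence "int n * k < int n * z" by simp
  hence "k < z" using n_pos by simp
  hence "int n * (k + 1) \<le> int n * z" by (intro mult_left_mono) auto
  thus ?thesis using z by (auto simp: val_ge_iff)
qed simp

lemma val_ge_all_imp_0: "(\<And>T. val_ge T x) \<Longrightarrow> x = 0"
proof (rule ccontr)
  assume all: "\<And>T. val_ge T x" and "x \<noteq> 0"
  then obtain z :: int where z: "v x = ereal (of_int z)" using v_nonzero by blast
  from all[of "int n * z + 1"] z \<open>x \<noteq> 0\<close> show False by (auto simp: val_ge_iff)
qed

text \<open>
  When the terms of a sum have pairwise distinct valuations, the valuation of the sum is the least of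
  theirs, so that a lower bound for the sum bounds each term.
\<close>

lemma val_ge_sum_distinct:
  assumes "finite A" "val_ge T (\<Sum>i\<in>A. x i)" "i \<in> A"
    and distinct: "\<And>i j. i \<in> A \<Longrightarrow> j \<in> A \<Longrightarrow> i \<noteq> j \<Longrightarrow> x i \<noteq> 0 \<Longrightarrow> v (x i) \<noteq> v (x j)"
  shows "val_ge T (x i)"
proof (rule ccontr)
  assume not: "\<not> val_ge T (x i)"
  have "Min ((\<lambda>i. v (x i)) ` A) \<in> (\<lambda>i. v (x i)) ` A" using assms(1,3) by (intro Min_in) auto
  then obtain a where a: "a \<in> A" "v (x a) = Min ((\<lambda>i. v (x i)) ` A)" by auto
  hence a_min: "v (x a) \<le> v (x j)" if "j \<in> A" for j using assms(1) that by simp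
  have na: "\<not> val_ge T (x a)"
  proof
    assume "val_ge T (x a)"
    also have "ereal (real n) * v (x a) \<le> ereal (real n) * v (x i)"
      by (intro ereal_mult_left_mono a_min assms) simp
    hence "val_ge T (x a) \<Longrightarrow> val_ge T (x i)" unfolding val_ge_def by (rule order_trans[rotated])
    ultimately show False using not by simp
  qed
  hence "x a \<noteq> 0" by auto
  then obtain z :: int where z: "v (x a) = ereal (of_int z)" using v_nonzero by blast
  with na \<open>x a \<noteq> 0\<close> have zT: "int n * z + 1 \<le> T" by (auto simp: val_ge_iff)
  have "val_ge (int n * z + 1) (x j)" if j: "j \<in> A - {a}" for j
  proof (cases "x j = 0")
    case False
    then obtain w :: int where w: "v (x j) = ereal (of_int w)" using v_nonzero by blast
    have "z \<noteq> w" using distinct[of j a] j a(1) False z w by auto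
    moreover have "z \<le> w" using a_min[of j] j z w by simp
    ultimately have "z < w" by simp
    hence "int n * z < int n * w" using n_pos by simp
    thus ?thesis using w by (auto simp: val_ge_iff)
  qed simp
  hence "val_ge (int n * z + 1) (\<Sum>j\<in>A - {a}. x j)" by (rule val_ge_sum)
  moreover have "(\<Sum>j\<in>A. x j) = x a + (\<Sum>j\<in>A - {a}. x j)" using assms(1) a(1) by (rule sum.remove)
  moreover have "val_ge (int n * z + 1) (\<Sum>j\<in>A. x j)" using assms(2) zT by (rule val_ge_mono)
  ultimately have "val_ge (int n * z + 1) (x a)" using val_ge_diff by fastforce
  thus False using z \<open>x a \<noteq> 0\<close> by (auto simp: val_ge_iff)
qed

end

lemma cong_mod_max_ideal_iff:
  assumes "scaled_valuation v n"
  shows "cong_mod x y (max_ideal_pow v t) \<longleftrightarrow> scaled_valuation.val_ge v n (int n * t) (x - y)"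
proof -
  interpret scaled_valuation v n by fact
  show ?thesis
  proof (cases "x = y")
    case False
    then obtain z :: int where z: "v (x - y) = ereal (of_int z)" using v_nonzero[of "x - y"] by auto
    show ?thesis using False z n_pos by (auto simp: cong_mod_def max_ideal_pow_def val_ge_iff)
  qed (simp add: cong_mod_def max_ideal_pow_def)
qed

section \<open>Divisibility by powers of the residue characteristic\<close>

lemma le_trunc_val_iff:
  assumes "prime p"
  shows "m \<le> trunc_val p \<nu> k \<longleftrightarrow> m \<le> \<nu> \<and> int p ^ m dvd k"
proof (cases "k = 0")
  case False
  have "\<not> is_unit (int p)" using assms prime_gt_1_nat[OF assms] by simp
  with False have "int p ^ m dvd k \<longleftrightarrow> m \<le> multiplicity (int p) k"
    by (intro power_dvd_iff_le_multiplicity) auto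
  thus ?thesis using False by (auto simp: trunc_val_def)
qed (simp add: trunc_val_def)

text \<open>
  \<open>v\<^sub>p(t choose s) \<ge> v\<^sub>p(t) - v\<^sub>p(s)\<close>, because \<open>s (t choose s) = t (t - 1 choose s - 1)\<close>.
\<close>

lemma power_dvd_binomial:
  fixes p :: nat
  assumes "prime p" "p ^ q dvd t" "\<not> p ^ Suc m dvd s" "m \<le> q" "0 < s"
  shows "p ^ (q - m) dvd (t choose s)"
proof (cases "t choose s = 0")
  case False
  hence "s \<le> t" by (meson binomial_eq_0 not_le)
  with assms(5) have "0 < t" by simp
  have "s * (t choose s) = t * ((t - 1) choose (s - 1))"
    using times_binomial_minus1_eq[OF assms(5), of t] by simp
  hence "p ^ q dvd s * (t choose s)" using assms(2) by simp
  hence "q \<le> multiplicity p (s * (t choose s))"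
    using False assms(1,5) by (intro multiplicity_geI) (auto dest: prime_gt_1_nat)
  also have "\<dots> = multiplicity p s + multiplicity p (t choose s)"
    using False assms(1,5) by (intro prime_elem_multiplicity_mult_distrib) auto
  also have "multiplicity p s \<le> m"
    using assms(3) multiplicity_dvd'[of "Suc m" p s] not_less_eq_eq by blast
  finally have "q - m \<le> multiplicity p (t choose s)" by simp
  thus ?thesis by (rule multiplicity_dvd')
qed (simp add: binomial_eq_0)

text \<open>
  \<open>(a p\<^sup>m choose p\<^sup>m) = a (a p\<^sup>m - 1 choose p\<^sup>m - 1)\<close>, and by Pascal's rule
  \<open>(a p\<^sup>m - 1 choose k)\<close> is congruent to \<open>(-1)\<^sup>k\<close> modulo \<open>p\<close> for \<open>k < p\<^sup>m\<close>.
\<close>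

lemma binomial_prime_power:
  fixes p a :: nat
  assumes "prime p" "0 < a"
  obtains e :: int where "int ((a * p ^ m) choose (p ^ m)) = int a + int p * int a * e"
proof -
  have "p > 0" using assms(1) by (simp add: prime_gt_0_nat)
  define q where "q = p ^ m"
  have q: "q > 0" using \<open>p > 0\<close> by (simp add: q_def)
  define N where "N = a * q - 1"
  have N: "a * q = Suc N" using assms(2) q by (simp add: N_def)
  have *: "int p dvd int (N choose k) - (-1) ^ k" if "k < q" for k
    using that
  proof (induction k)
    case (Suc k)
    have m: "m \<noteq> 0" using Suc.prems by (cases m) (auto simp: q_def)
    have "\<not> p ^ Suc (m - 1) dvd Suc k"
      using Suc.prems m by (auto simp: q_def dest!: dvd_imp_le)
    hence "p ^ (m - (m - 1)) dvd (a * q) choose Suc k"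
      using assms(1) by (intro power_dvd_binomial) (auto simp: q_def)
    hence "int p dvd int (Suc N choose Suc k)" using m unfolding N int_dvd_int_iff by simp
    moreover have "int p dvd int (N choose k) - (-1) ^ k" using Suc by simp
    ultimately have "int p dvd int (Suc N choose Suc k) - (int (N choose k) - (-1) ^ k)"
      by (rule dvd_diff)
    thus ?case by (simp add: algebra_simps)
  qed simp
  have "int p dvd (-1) ^ (q - 1) - 1"
  proof (cases "p = 2")
    case False
    have "2 < p" using prime_ge_2_nat[OF assms(1)] False by simp
    hence "odd p" using assms(1) prime_odd_nat by blast
    hence "even (q - 1)" by (simp add: q_def)
    thus ?thesis by simp
  qed simp
  moreover have "int p dvd int (N choose (q - 1)) - (-1) ^ (q - 1)" using * q by simp
  ultimately have "int p dvd int (N choose (q - 1)) - 1"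
    by (metis (no_types) diff_add_cancel add_diff_eq dvd_add)
  then obtain e where e: "int (N choose (q - 1)) - 1 = int p * e" by (rule dvdE)
  have "q * ((a * q) choose q) = a * q * ((a * q - 1) choose (q - 1))"
    using times_binomial_minus1_eq[OF q, of "a * q"] by simp
  hence "(a * q) choose q = a * (N choose (q - 1))" using q by (simp add: N_def)
  hence "int ((a * q) choose q) = int a * int (N choose (q - 1))" by simp
  also have "int (N choose (q - 1)) = 1 + int p * e" using e by linarith
  finally have "int ((a * q) choose q) = int a + int p * int a * e"
    by (simp only: distrib_left mult_1_right mult.assoc mult.left_commute)
  thus ?thesis using that unfolding q_def by blast
qed

text \<open>
  The properties of the indices of inseparability \<open>I 0, \<dots>, I \<nu>\<close> that the argument needs. The last but
  one assumption is \<open>I m \<le> I m' + (m' - m) e\<close>, where \<open>e\<close> is the absolute ramification index of the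
  extension field; stated with \<open>val_ge\<close> it makes sense for \<open>e = \<infinity>\<close> as well.
\<close>

locale insep_data = scaled_valuation v n for v :: "'a::field \<Rightarrow> ereal" and n +
  fixes p \<nu> :: nat and I :: "nat \<Rightarrow> int"
  assumes prime_p: "prime p"
    and power_dvd_n: "p ^ \<nu> dvd n"
    and I_antimono: "\<And>m m'. m \<le> m' \<Longrightarrow> m' \<le> \<nu> \<Longrightarrow> I m' \<le> I m"
    and I_top: "I \<nu> = 0"
    and I_shift: "\<And>m m'. m \<le> m' \<Longrightarrow> m' \<le> \<nu> \<Longrightarrow> val_ge (I m - I m') (of_nat (p ^ (m' - m)))"
    and val_ge_p: "val_ge (int n) (of_nat p)"
begin

text \<open>
  The truncated \<open>p\<close>-adic valuation on the natural numbers; its value at \<open>0\<close> is \<open>\<nu>\<close>.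
\<close>

definition tval :: "nat \<Rightarrow> nat" where "tval t = trunc_val p \<nu> (int t)"

text \<open>
  The Hasse-Herbrand function of index \<open>q\<close> at the integer \<open>l\<close>.
\<close>

definition phi :: "nat \<Rightarrow> nat \<Rightarrow> int" where
  "phi l q = Min ((\<lambda>m. I m + int (p ^ m * l)) ` {..q})"

lemma le_tval_iff: "m \<le> tval t \<longleftrightarrow> m \<le> \<nu> \<and> p ^ m dvd t"
  unfolding tval_def le_trunc_val_iff[OF prime_p] using int_dvd_int_iff[of "p ^ m" t] by simp

lemma tval_le: "tval t \<le> \<nu>" using le_tval_iff by blast

lemma tval_dvd: "p ^ tval t dvd t" using le_tval_iff by blast

lemma tval_less_not_dvd: "tval t < \<nu> \<Longrightarrow> \<not> p ^ Suc (tval t) dvd t"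
  using le_tval_iff[of "Suc (tval t)" t] by auto

lemma tval_n [simp]: "tval n = \<nu>"
  using le_tval_iff[of \<nu> n] tval_le[of n] power_dvd_n by auto

lemma tval_0 [simp]: "tval 0 = \<nu>"
  using le_tval_iff[of \<nu> 0] tval_le[of 0] by auto

lemma tval_add: "min (tval s) (tval t) \<le> tval (s + t)"
  using le_tval_iff[of "min (tval s) (tval t)"] by (meson dvd_add min.cobounded1 min.cobounded2 order_refl)

lemma tval_mult: "tval s \<le> tval (s * t)"
  using le_tval_iff by (meson dvd_mult2 order_refl)

lemma tval_diff: "min (tval t) (tval s) \<le> tval (t - s)"
  using le_tval_iff[of "min (tval t) (tval s)"] by (meson dvd_diff_nat min.cobounded1 min.cobounded2 order_refl)

lemma tval_cong: assumes "s mod n = t mod n" shows "tval s = tval t"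
proof -
  have "p ^ m dvd s \<longleftrightarrow> p ^ m dvd t" if "m \<le> \<nu>" for m
    using assms power_dvd_n that by (metis dvd_mod_iff dvd_trans le_imp_power_dvd)
  hence "m \<le> tval s \<longleftrightarrow> m \<le> tval t" for m unfolding le_tval_iff by auto
  thus ?thesis by (meson order_antisym order_refl)
qed

lemma tval_mod [simp]: "tval (t mod n) = tval t" by (rule tval_cong) simp

lemma tval_compl: "i \<le> n \<Longrightarrow> tval (n - i) = tval i"
  using tval_diff[of n i] tval_diff[of n "n - i"] tval_le[of i] tval_le[of "n - i"]
  by (simp add: min_def split: if_splits)

lemma I_nonneg: "m \<le> \<nu> \<Longrightarrow> 0 \<le> I m" using I_antimono[of m \<nu>] I_top by simp

lemma phi_le: "m \<le> q \<Longrightarrow> phi l q \<le> I m + int (p ^ m * l)"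
  unfolding phi_def by (intro Min_le) auto

lemma phi_attained: obtains m where "m \<le> q" "phi l q = I m + int (p ^ m * l)"
proof -
  have "phi l q \<in> (\<lambda>m. I m + int (p ^ m * l)) ` {..q}"
    unfolding phi_def by (intro Min_in) auto
  thus ?thesis using that by auto
qed

lemma phi_antimono: "q \<le> q' \<Longrightarrow> phi l q' \<le> phi l q"
  unfolding phi_def by (intro Min_antimono) auto

lemma p_ge_2: "2 \<le> p" using prime_p by (rule prime_ge_2_nat)

lemma phi_strict_mono: assumes "l < l'" shows "phi l q < phi l' q"
proof -
  obtain m where m: "m \<le> q" "phi l' q = I m + int (p ^ m * l')" by (rule phi_attained)
  have "p ^ m * l < p ^ m * l'" using assms p_ge_2 by simp
  thus ?thesis using phi_le[OF m(1), of l] m(2) by linarith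
qed

lemma phi_mono: assumes "l \<le> l'" shows "phi l q \<le> phi l' q"
  using assms phi_strict_mono[of l l' q] by (cases "l = l'") auto

lemma phi_gt_I: assumes "q \<le> \<nu>" "1 \<le> l" shows "I q < phi l q"
proof -
  obtain m where m: "m \<le> q" "phi l q = I m + int (p ^ m * l)" by (rule phi_attained)
  have "0 < p ^ m * l" using assms p_ge_2 by simp
  thus ?thesis using m I_antimono[OF m(1) assms(1)] by linarith
qed

text \<open>
  The function \<open>phi l\<close> is antitone. When it drops between \<open>m\<close> and \<open>q\<close>, the drop is less than the drop
  of \<open>I\<close> between \<open>m\<close> and some \<open>m' \<le> q\<close>, where the minimum that defines \<open>phi l q\<close> is attained.
\<close>

lemma phi_jump:
  assumes "m \<le> q" "q \<le> \<nu>" "1 \<le> l"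
  obtains "phi l m \<le> phi l q"
  | m' where "m < m'" "m' \<le> q" "phi l m - phi l q < I m - I m'"
proof -
  obtain m' where m': "m' \<le> q" "phi l q = I m' + int (p ^ m' * l)" by (rule phi_attained)
  show ?thesis
  proof (cases "m' \<le> m")
    case True
    thus ?thesis using that(1) phi_le[OF True, of l] m' by simp
  next
    case False
    hence "p ^ m * l < p ^ m' * l" using p_ge_2 assms(3) by simp
    hence "int (p ^ m * l) < int (p ^ m' * l)" by linarith
    with phi_le[of m m l] m' False show ?thesis by (intro that(2)[of m']) auto
  qed
qed

text \<open>
  Reducing \<open>X\<^sup>t\<close> modulo a polynomial of degree \<open>n\<close> replaces it by monomials \<open>x X\<^sup>t\<^sup>-\<^sup>i\<close>. For
  \<open>0 < i < n\<close> the gain \<open>n v(x) - i\<close> exceeds the change of the threshold from \<open>phi l (tval t)\<close> to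
  \<open>phi l (tval (t - i))\<close>.
\<close>

lemma phi_reduction:
  assumes "1 \<le> l" "0 < i" "i < n" "i \<le> t" "val_ge (I (tval i) + int i) x"
  shows "val_ge (phi l (tval (t - i)) - phi l (tval t) + 1 + int i) x"
proof -
  have "val_ge (int i) x" using assms(5) I_nonneg[OF tval_le] by (auto elim: val_ge_mono)
  hence i1: "val_ge (int i + 1) x"
    using assms(2,3) by (intro val_ge_succ) (auto dest: zdvd_imp_le)
  have d: "min (tval t) (tval i) \<le> tval (t - i)" by (rule tval_diff)
  show ?thesis
  proof (cases "tval t \<le> tval i")
    case True
    hence "phi l (tval (t - i)) \<le> phi l (tval t)" using d by (intro phi_antimono) auto
    thus ?thesis using i1 by (auto elim: val_ge_mono)
  next
    case False
    hence *: "phi l (tval (t - i)) \<le> phi l (tval i)" using d by (intro phi_antimono) auto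
    from False have "tval i \<le> tval t" by simp
    from this tval_le assms(1) show ?thesis
    proof (cases rule: phi_jump)
      case 1
      thus ?thesis using i1 * by (auto elim: val_ge_mono)
    next
      case (2 m')
      have "0 \<le> I m'" using 2 tval_le[of t] by (intro I_nonneg) auto
      thus ?thesis using assms(5) * 2 by (auto elim: val_ge_mono)
    qed
  qed
qed

text \<open>
  The same, with the gain \<open>n v(t choose s) + s l\<close>, for the monomials \<open>(t choose s) r\<^sup>s X\<^sup>t\<^sup>+\<^sup>s\<^sup>l\<close> that the substitution of \<open>X + r X\<^sup>l\<^sup>+\<^sup>1\<close> for \<open>X\<close>
  produces from \<open>X\<^sup>t\<close>.
\<close>

lemma phi_substitution:
  assumes "1 \<le> l" "0 < s"
  shows "val_ge (phi l (tval (t + s * l)) - phi l (tval t) + 1 - int (s * l)) (of_nat (t choose s))"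
proof -
  have sl: "1 \<le> int (s * l)" using assms by (metis One_nat_def Suc_le_eq nat_0_less_mult_iff of_nat_1 of_nat_le_iff zero_less_iff_neq_zero not_one_le_zero)
  have d: "min (tval t) (tval s) \<le> tval (t + s * l)"
    using tval_add[of t "s * l"] tval_mult[of s l] by simp
  show ?thesis
  proof (cases "tval t \<le> tval s")
    case True
    hence "phi l (tval (t + s * l)) \<le> phi l (tval t)" using d by (intro phi_antimono) auto
    thus ?thesis using sl by (auto intro!: val_ge_mono[OF val_ge_of_nat])
  next
    case False
    hence *: "phi l (tval (t + s * l)) \<le> phi l (tval s)" using d by (intro phi_antimono) auto
    from False have st: "tval s \<le> tval t" by simp
    from this tval_le assms(1) show ?thesis
    proof (cases rule: phi_jump)
      case 1
      thus ?thesis using sl * by (auto intro!: val_ge_mono[OF val_ge_of_nat])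
    next
      case (2 m')
      have "p ^ (tval t - tval s) dvd (t choose s)"
        using False tval_le[of t] st by (intro power_dvd_binomial prime_p tval_dvd tval_less_not_dvd assms) auto
      hence "p ^ (m' - tval s) dvd (t choose s)"
        using 2 by (meson diff_le_mono dvd_trans le_imp_power_dvd)
      moreover have "val_ge (I (tval s) - I m') (of_nat (p ^ (m' - tval s)))"
        using 2 tval_le[of t] by (intro I_shift) auto
      ultimately have "val_ge (I (tval s) - I m') (of_nat (t choose s))" by (rule val_ge_of_nat_dvd[rotated])
      thus ?thesis using 2 * sl by (auto elim: val_ge_mono)
    qed
  qed
qed

lemma I_shift_coeff:
  assumes "m \<le> \<nu>" "p ^ (q - m) dvd d" "m \<le> q" "q \<le> \<nu>" "val_ge (I q + T) x"
  shows "val_ge (I m + T) (x * of_nat d)"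
proof -
  have "val_ge (I m - I q) (of_nat d)" using val_ge_of_nat_dvd[OF I_shift assms(2)] assms by simp
  from val_ge_mult[OF assms(5) this] show ?thesis by (simp add: algebra_simps)
qed

text \<open>
  Here \<open>x\<close> is the coefficient of \<open>X\<^sup>n\<^sup>-\<^sup>i\<close> in an admissible polynomial. For \<open>i = 0\<close> it is the leading
  coefficient, of which only integrality is used; in that case \<open>tval (n - i) = \<nu>\<close> and \<open>I \<nu> = 0\<close> give
  the bound.
\<close>

lemma val_ge_coeff_binomial:
  assumes "i < n" "val_ge (if i = 0 then 0 else I (tval i) + int i) x" "0 < s"
  shows "val_ge (I (tval s) + int i) (x * of_nat ((n - i) choose s))"
proof -
  have x: "val_ge (I (tval i) + int i) x" using assms(2) I_top by (auto split: if_splits)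
  show ?thesis
  proof (cases "tval i \<le> tval s")
    case True
    hence "I (tval s) \<le> I (tval i)" by (intro I_antimono tval_le)
    hence "val_ge (I (tval s) + int i) x" using x by (auto elim: val_ge_mono)
    thus ?thesis by (rule val_ge_mult_int) simp
  next
    case False
    have "p ^ tval i dvd n - i" using le_tval_iff[of "tval i" "n - i"] tval_compl[of i] assms(1) by simp
    moreover have "\<not> p ^ Suc (tval s) dvd s" using False tval_le[of i] by (intro tval_less_not_dvd) simp
    ultimately have "p ^ (tval i - tval s) dvd ((n - i) choose s)"
      using False assms(3) by (intro power_dvd_binomial prime_p) auto
    thus ?thesis using False x by (intro I_shift_coeff[where q = "tval i"] tval_le) auto
  qed
qed

text \<open>
  The monomials that the substitution produces from an admissible polynomial are above the threshold,
  strictly so when the exponent is less divisible by \<open>p\<close> than \<open>s\<close>.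
\<close>

lemma phi_leading:
  assumes "1 \<le> l" "i < n" "val_ge (if i = 0 then 0 else I (tval i) + int i) x" "0 < s"
  shows "val_ge (phi l (tval (n - i + s * l)) + int i - int (s * l)) (x * of_nat ((n - i) choose s))"
    and "tval (n - i + s * l) < tval s \<Longrightarrow>
      val_ge (phi l (tval (n - i + s * l)) + int i - int (s * l) + 1) (x * of_nat ((n - i) choose s))"
proof -
  let ?q = "tval (n - i + s * l)"
  have C: "val_ge (I (tval s) + int i) (x * of_nat ((n - i) choose s))"
    by (rule val_ge_coeff_binomial) fact+
  have *: "val_ge (phi l ?q + int i - int (s * l) + 1) (x * of_nat ((n - i) choose s))" if "?q < tval s"
  proof -
    have "min (tval i) (tval s) \<le> ?q"
      using tval_add[of "n - i" "s * l"] tval_compl[of i] tval_mult[of s l] assms(2) by auto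
    hence iq: "tval i \<le> ?q" using that by simp
    hence "I ?q \<le> I (tval i)" by (intro I_antimono tval_le)
    moreover have "val_ge (I (tval i) + int i) x" using assms(3) I_top by (auto split: if_splits)
    ultimately have "val_ge (I ?q + int i) x" by (auto elim: val_ge_mono)
    hence 1: "val_ge (I ?q + int i) (x * of_nat ((n - i) choose s))" by (rule val_ge_mult_int) simp
    have "p ^ ?q < p ^ tval s" using that p_ge_2 by simp
    also have "p ^ tval s \<le> s" using tval_dvd assms(4) by (rule dvd_imp_le)
    finally have "p ^ ?q * l < s * l" using assms(1) by simp
    hence "int (p ^ ?q * l) < int (s * l)" by linarith
    with phi_le[of ?q ?q l] 1 show ?thesis by (auto elim: val_ge_mono)
  qed
  thus "?q < tval s \<Longrightarrow> val_ge (phi l ?q + int i - int (s * l) + 1) (x * of_nat ((n - i) choose s))" .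
  show "val_ge (phi l ?q + int i - int (s * l)) (x * of_nat ((n - i) choose s))"
  proof (cases "?q < tval s")
    case True
    thus ?thesis using * by (auto elim: val_ge_mono)
  next
    case False
    have "p ^ tval s \<le> s" using tval_dvd assms(4) by (rule dvd_imp_le)
    hence "p ^ tval s * l \<le> s * l" by simp
    hence "int (p ^ tval s * l) \<le> int (s * l)" by linarith
    with phi_le[of "tval s" ?q l] False C show ?thesis by (auto elim: val_ge_mono)
  qed
qed

end

section \<open>Polynomials above the Hasse-Herbrand thresholds\<close>

lemma poly_mod_sum_left: "(\<Sum>i\<in>A. f i) mod g = (\<Sum>i\<in>A. f i mod g)" for g :: "'a::field poly"
  by (induction A rule: infinite_finite_induct) (simp_all add: poly_mod_add_left)

text \<open>
  The polynomial \<open>X + r X\<^sup>l\<^sup>+\<^sup>1\<close>, which maps a uniformizer \<open>\<pi>\<close> to \<open>\<pi> + r \<pi>\<^sup>l\<^sup>+\<^sup>1\<close>.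
\<close>

definition shift_poly :: "'a::comm_semiring_1 \<Rightarrow> nat \<Rightarrow> 'a poly" where
  "shift_poly r l = monom 1 1 + monom r (l + 1)"

lemma shift_poly_power:
  "shift_poly r l ^ t = (\<Sum>s\<le>t. monom (of_nat (t choose s) * r ^ s) (t + s * l))"
proof -
  have "shift_poly r l ^ t = (\<Sum>s\<le>t. of_nat (t choose s) * monom r (l + 1) ^ s * monom 1 1 ^ (t - s))"
    unfolding shift_poly_def by (subst add.commute) (rule binomial_ring)
  also have "\<dots> = (\<Sum>s\<le>t. monom (of_nat (t choose s) * r ^ s) (t + s * l))"
  proof (intro sum.cong refl)
    fix s assume "s \<in> {..t}"
    hence "(l + 1) * s + (t - s) = t + s * l" by (simp add: algebra_simps)
    thus "of_nat (t choose s) * monom r (l + 1) ^ s * monom 1 1 ^ (t - s) =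
        monom (of_nat (t choose s) * r ^ s) (t + s * l)"
      by (simp add: monom_power mult_monom of_nat_poly smult_monom mult.commute[of l s] add.commute[of _ t])
  qed
  finally show ?thesis .
qed

lemma pcompose_monom': "pcompose (monom x t) q = smult x (q ^ t)"
  for q :: "'a::comm_ring_1 poly"
  by (induction t) (simp_all add: monom_0 monom_Suc pcompose_pCons)

lemma smult_sum': "smult c (\<Sum>i\<in>A. f i) = (\<Sum>i\<in>A. smult c (f i))"
  by (induction A rule: infinite_finite_induct) (simp_all add: smult_add_right)

lemma pcompose_shift_poly_diff:
  fixes q :: "'a::comm_ring_1 poly"
  shows "pcompose q (shift_poly r l) - q =
    (\<Sum>t\<le>degree q. \<Sum>s\<in>{1..t}. monom (coeff q t * of_nat (t choose s) * r ^ s) (t + s * l))"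
proof -
  have "pcompose q (shift_poly r l) = (\<Sum>t\<le>degree q. smult (coeff q t) (shift_poly r l ^ t))"
    by (subst poly_as_sum_of_monoms[of q, symmetric])
       (simp add: pcompose_sum pcompose_monom' del: poly_as_sum_of_monoms)
  also have "\<dots> = (\<Sum>t\<le>degree q. monom (coeff q t) t +
      (\<Sum>s\<in>{1..t}. monom (coeff q t * of_nat (t choose s) * r ^ s) (t + s * l)))"
  proof (intro sum.cong refl)
    fix t :: nat
    have "{..t} = insert 0 {1..t}" by auto
    thus "smult (coeff q t) (shift_poly r l ^ t) = monom (coeff q t) t +
        (\<Sum>s\<in>{1..t}. monom (coeff q t * of_nat (t choose s) * r ^ s) (t + s * l))"
      by (simp add: shift_poly_power smult_sum' smult_monom smult_add_right mult.assoc)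
  qed
  also have "\<dots> = q + (\<Sum>t\<le>degree q. \<Sum>s\<in>{1..t}.
      monom (coeff q t * of_nat (t choose s) * r ^ s) (t + s * l))"
    by (simp add: sum.distrib poly_as_sum_of_monoms)
  finally show ?thesis by simp
qed

context insep_data
begin

text \<open>
  Give \<open>x X\<^sup>t\<close> the weight \<open>n v(x) + t\<close>, which is the valuation of its value at a uniformizer.
  \<open>above l T q\<close> says that each term \<open>x X\<^sup>t\<close> of \<open>q\<close> has weight at least \<open>T + phi l (tval t)\<close>: the
  threshold depends on the divisibility of the exponent by \<open>p\<close>.
\<close>

definition above :: "nat \<Rightarrow> int \<Rightarrow> 'a poly \<Rightarrow> bool" where
  "above l T q \<longleftrightarrow> (\<forall>t. val_ge (T + phi l (tval t) - int t) (coeff q t))"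

lemma above_0 [simp]: "above l T 0" by (simp add: above_def)

lemma above_mono: "above l T q \<Longrightarrow> S \<le> T \<Longrightarrow> above l S q"
  unfolding above_def by (meson add_right_mono diff_right_mono val_ge_mono)

lemma above_add: "above l T q \<Longrightarrow> above l T q' \<Longrightarrow> above l T (q + q')"
  by (simp add: above_def val_ge_add)

lemma above_uminus: "above l T (- q) \<longleftrightarrow> above l T q"
  by (simp add: above_def)

lemma above_diff: "above l T q \<Longrightarrow> above l T q' \<Longrightarrow> above l T (q - q')"
  by (simp add: above_def val_ge_diff)

lemma above_sum: "(\<And>i. i \<in> A \<Longrightarrow> above l T (f i)) \<Longrightarrow> above l T (sum f A)"
  by (simp add: above_def coeff_sum val_ge_sum)

lemma above_monom [simp]: "above l T (monom x t) \<longleftrightarrow> val_ge (T + phi l (tval t) - int t) x"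
  by (auto simp: above_def)

text \<open>
  Monic polynomials of degree \<open>n\<close> whose coefficient of \<open>X\<^sup>n\<^sup>-\<^sup>i\<close> has at least the valuation that the
  indices \<open>I\<close> prescribe. Since \<open>I \<ge> 0\<close>, such a polynomial has its lower coefficients in the maximal
  ideal.
\<close>

definition admissible :: "'a poly \<Rightarrow> bool" where
  "admissible f \<longleftrightarrow> degree f = n \<and> lead_coeff f = 1 \<and>
     (\<forall>i\<in>{1..n}. val_ge (I (tval i) + int i) (coeff f (n - i)))"

text \<open>
  Up to terms above the next threshold, reduction modulo \<open>f\<close> is reduction modulo \<open>X\<^sup>n + f(0)\<close>.
\<close>

lemma monom_mod_admissible:
  assumes "admissible f" "1 \<le> l" "val_ge (T + phi l (tval t) - int t) x"
  shows "above l (T + 1)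
    (monom x t mod f - monom (x * (- coeff f 0) ^ (t div n)) (t mod n))"
    and "above l T (monom x t mod f)"
proof -
  have n: "degree f = n" and lead: "coeff f n = 1"
    and f: "\<And>i. i \<in> {1..n} \<Longrightarrow> val_ge (I (tval i) + int i) (coeff f (n - i))"
    using assms(1) by (auto simp: admissible_def)
  have f0: "val_ge (int n) (- coeff f 0)" using f[of n] n_pos I_top by simp
  have red: "above l T (monom (x * (- coeff f 0) ^ (t div n)) (t mod n))"
    if "val_ge (T + phi l (tval t) - int t) x" for T t x
  proof -
    have "val_ge (int (t div n) * int n) ((- coeff f 0) ^ (t div n))" by (rule val_ge_power[OF f0])
    from val_ge_mult[OF that this] have "val_ge (T + phi l (tval t) - int t + int (t div n) * int n)
        (x * (- coeff f 0) ^ (t div n))" .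
    moreover have "int t = int (t div n) * int n + int (t mod n)"
      by (simp flip: of_nat_mult of_nat_add)
    hence "T + phi l (tval t) - int t + int (t div n) * int n = T + phi l (tval t) - int (t mod n)"
      by linarith
    ultimately show ?thesis by simp
  qed
  have *: "above l (T + 1) (monom x t mod f - monom (x * (- coeff f 0) ^ (t div n)) (t mod n))"
    if "val_ge (T + phi l (tval t) - int t) x" for T t x
    using that
  proof (induction t arbitrary: T x rule: less_induct)
    case (less t)
    show ?case
    proof (cases "t < n")
      case True
      have "degree (monom x t) < degree f"
        using True n degree_monom_le[of x t] by simp
      hence "monom x t mod f = monom x t" by (rule mod_poly_less)
      thus ?thesis using True by simp
    next
      case False
      define g where "g = (\<Sum>i\<in>{1..n}. monom (coeff f (n - i)) (n - i))"
      have "f = (\<Sum>i\<le>n. monom (coeff f i) i)" using poly_as_sum_of_monoms[of f] n by simp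
      also have "{..n} = insert n {..<n}" by auto
      also have "(\<Sum>i\<in>insert n {..<n}. monom (coeff f i) i) =
          monom 1 n + (\<Sum>i<n. monom (coeff f i) i)" by (simp add: lead)
      also have "(\<Sum>i<n. monom (coeff f i) i) = g" unfolding g_def
        by (rule sum.reindex_bij_witness[of _ "\<lambda>i. n - i" "\<lambda>i. n - i"]) auto
      finally have f_eq: "monom 1 n = f - g" by simp
      have "monom x t = monom x (t - n) * monom 1 n" using False by (simp add: mult_monom)
      also have "\<dots> = monom x (t - n) * f - monom x (t - n) * g" by (simp add: f_eq algebra_simps)
      finally have "monom x t mod f = - ((monom x (t - n) * g) mod f)"
        by (simp add: poly_mod_diff_left)
      also have "monom x (t - n) * g = (\<Sum>i\<in>{1..n}. monom (x * coeff f (n - i)) (t - i))"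
        unfolding g_def sum_distrib_left using False by (intro sum.cong) (auto simp: mult_monom)
      also have "{1..n} = insert n {0<..<n}" using n_pos by auto
      also have "(\<Sum>i\<in>insert n {0<..<n}. monom (x * coeff f (n - i)) (t - i)) =
          (\<Sum>i\<in>{0<..<n}. monom (x * coeff f (n - i)) (t - i)) - monom (x * (- coeff f 0)) (t - n)"
        by (simp flip: minus_monom)
      finally have eq: "monom x t mod f = monom (x * (- coeff f 0)) (t - n) mod f -
          (\<Sum>i\<in>{0<..<n}. monom (x * coeff f (n - i)) (t - i) mod f)"
        by (simp add: poly_mod_diff_left poly_mod_sum_left)
      have "above l (T + 1) (monom (x * (- coeff f 0)) (t - n) mod f -
          monom (x * (- coeff f 0) * (- coeff f 0) ^ ((t - n) div n)) ((t - n) mod n))"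
      proof (rule less.IH)
        show "t - n < t" using False n_pos by simp
        have "tval (t - n) = tval t" using False by (intro tval_cong) (simp add: mod_if)
        with val_ge_mult[OF less.prems f0] False
        show "val_ge (T + phi l (tval (t - n)) - int (t - n)) (x * - coeff f 0)"
          by (simp add: algebra_simps of_nat_diff)
      qed
      moreover have "x * (- coeff f 0) * (- coeff f 0) ^ ((t - n) div n) =
          x * (- coeff f 0) ^ (t div n)"
        using False n_pos by (simp add: le_div_geq[of n t])
      moreover have "(t - n) mod n = t mod n" using False by (simp add: mod_if)
      ultimately have 1: "above l (T + 1) (monom (x * (- coeff f 0)) (t - n) mod f -
          monom (x * (- coeff f 0) ^ (t div n)) (t mod n))" by simp
      have 2: "above l (T + 1) (monom (x * coeff f (n - i)) (t - i) mod f)" if i: "i \<in> {0<..<n}" for i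
      proof -
        let ?x = "x * coeff f (n - i)"
        have "val_ge (phi l (tval (t - i)) - phi l (tval t) + 1 + int i) (coeff f (n - i))"
          using i False f[of i] assms(2) by (intro phi_reduction) auto
        from val_ge_mult[OF less.prems this] have x: "val_ge ((T + 1) + phi l (tval (t - i)) - int (t - i)) ?x"
          using i False by (simp add: algebra_simps of_nat_diff)
        have "above l (T + 1 + 1) (monom ?x (t - i) mod f -
            monom (?x * (- coeff f 0) ^ ((t - i) div n)) ((t - i) mod n))"
          using i False x by (intro less.IH) auto
        hence "above l (T + 1) (monom ?x (t - i) mod f -
            monom (?x * (- coeff f 0) ^ ((t - i) div n)) ((t - i) mod n))"
          by (rule above_mono) simp
        from above_add[OF this red[OF x]] show ?thesis by simp
      qed
      have "above l (T + 1) (\<Sum>i\<in>{0<..<n}. monom (x * coeff f (n - i)) (t - i) mod f)"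
        by (intro above_sum 2)
      from above_diff[OF 1 this] show ?thesis unfolding eq by (simp only: diff_diff_eq add.commute)
    qed
  qed
  show 1: "above l (T + 1) (monom x t mod f - monom (x * (- coeff f 0) ^ (t div n)) (t mod n))"
    by (rule *) fact
  hence "above l T (monom x t mod f - monom (x * (- coeff f 0) ^ (t div n)) (t mod n))"
    by (rule above_mono) simp
  from above_add[OF this red[OF assms(3)]] show "above l T (monom x t mod f)" by simp
qed

lemma above_mod:
  assumes "admissible f" "1 \<le> l" "above l T q"
  shows "above l T (q mod f)"
proof -
  have "q mod f = (\<Sum>t\<le>degree q. monom (coeff q t) t mod f)"
    using poly_mod_sum_left[of "\<lambda>t. monom (coeff q t) t" "{..degree q}" f]
    by (simp add: poly_as_sum_of_monoms)
  also have "above l T \<dots>" using assms by (intro above_sum monom_mod_admissible(2)) (auto simp: above_def)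
  finally show ?thesis .
qed

lemma above_substitution:
  assumes "1 \<le> l" "val_ge 0 r" "above l T q"
  shows "above l (T + 1) (pcompose q (shift_poly r l) - q)"
  unfolding pcompose_shift_poly_diff
proof (intro above_sum)
  fix t s :: nat assume s: "s \<in> {1..t}"
  have "val_ge (T + phi l (tval t) - int t) (coeff q t)" using assms by (simp add: above_def)
  moreover have "val_ge (phi l (tval (t + s * l)) - phi l (tval t) + 1 - int (s * l)) (of_nat (t choose s))"
    using s assms by (intro phi_substitution) auto
  ultimately have "val_ge ((T + phi l (tval t) - int t) +
      (phi l (tval (t + s * l)) - phi l (tval t) + 1 - int (s * l)))
      (coeff q t * of_nat (t choose s))" by (rule val_ge_mult)
  hence "val_ge (T + 1 + phi l (tval (t + s * l)) - int (t + s * l)) (coeff q t * of_nat (t choose s))"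
    by (simp add: algebra_simps)
  thus "above l (T + 1) (monom (coeff q t * of_nat (t choose s) * r ^ s) (t + s * l))"
    unfolding above_monom by (rule val_ge_mult_int) (rule val_ge_power_0[OF assms(2)])
qed

lemma admissible_coeff:
  assumes "admissible f" "0 < t" "t \<le> n"
  shows "val_ge (if n - t = 0 then 0 else I (tval (n - t)) + int (n - t)) (coeff f t)"
proof (cases "t = n")
  case True
  with assms(1) have "coeff f t = 1" by (auto simp: admissible_def)
  thus ?thesis using True by simp
next
  case False
  with assms have "n - t \<in> {1..n}" by auto
  with assms have "val_ge (I (tval (n - t)) + int (n - t)) (coeff f (n - (n - t)))"
    unfolding admissible_def by blast
  with False assms show ?thesis by simp
qed

lemma above_shift_admissible:
  assumes "admissible f" "1 \<le> l" "val_ge 0 r"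
  shows "above l (int n) (pcompose f (shift_poly r l) - f)"
  unfolding pcompose_shift_poly_diff
proof (intro above_sum)
  fix t s assume "t \<in> {..degree f}" and s: "s \<in> {1..t}"
  hence t: "t \<le> n" "0 < t" using assms(1) by (auto simp: admissible_def)
  have "val_ge (phi l (tval (n - (n - t) + s * l)) + int (n - t) - int (s * l))
      (coeff f t * of_nat ((n - (n - t)) choose s))"
    using assms(2) s t by (intro phi_leading admissible_coeff assms(1)) auto
  hence "val_ge (int n + phi l (tval (t + s * l)) - int (t + s * l)) (coeff f t * of_nat (t choose s))"
    using t by (simp add: algebra_simps of_nat_diff)
  thus "above l (int n) (monom (coeff f t * of_nat (t choose s) * r ^ s) (t + s * l))"
    unfolding above_monom by (rule val_ge_mult_int) (rule val_ge_power_0[OF assms(3)])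
qed

text \<open>
  Every polynomial is above some threshold, since it has finitely many coefficients.
\<close>

lemma above_exists: "\<exists>T. above l T q"
proof -
  have "\<exists>T. val_ge (T + phi l (tval t) - int t) (coeff q t)" for t
  proof (cases "coeff q t = 0")
    case False
    then obtain z :: int where z: "v (coeff q t) = ereal (of_int z)" using v_nonzero by blast
    show ?thesis by (intro exI[of _ "int n * z - phi l (tval t) + int t"]) (auto simp: val_ge_iff z)
  qed simp
  then obtain T where T: "\<And>t. val_ge (T t + phi l (tval t) - int t) (coeff q t)" by metis
  define M where "M = Min (T ` {..degree q})"
  have "val_ge (M + phi l (tval t) - int t) (coeff q t)" for t
  proof (cases "t \<le> degree q")
    case True
    hence "M \<le> T t" by (auto simp: M_def)
    thus ?thesis using T[of t] by (auto elim: val_ge_mono)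
  next
    case False
    thus ?thesis by (simp add: coeff_eq_0)
  qed
  thus ?thesis unfolding above_def by blast
qed

text \<open>
  Write \<open>D = f1 - f\<close> and \<open>\<psi> = X + r X\<^sup>l\<^sup>+\<^sup>1\<close>. As \<open>f\<close> divides \<open>f1 \<circ> \<psi>\<close>, \<open>D\<close> is the negative of the sum
  of \<open>D \<circ> \<psi> - D\<close> and \<open>f \<circ> \<psi> - f\<close>, both reduced modulo \<open>f\<close>. The first summand is one step higher than
  \<open>D\<close>, so that \<open>D\<close> climbs until it is as high as the second, and then it is determined by the second up
  to the next step.
\<close>

proposition above_perturbation:
  assumes f: "admissible f" and f1: "degree f1 = n" "lead_coeff f1 = 1"
    and l: "1 \<le> l" and r: "val_ge 0 r" and dvd: "f dvd pcompose f1 (shift_poly r l)"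
  shows "above l (int n) (f1 - f)"
    and "above l (int n + 1) ((f1 - f) + (pcompose f (shift_poly r l) - f) mod f)"
proof -
  let ?S = "\<lambda>q. pcompose q (shift_poly r l) - q"
  have degf: "degree f = n" and lead: "lead_coeff f = 1" using f by (auto simp: admissible_def)
  have "degree (f1 - f) < n"
    using eq_zero_or_degree_less[of "f1 - f" n] degree_diff_le[of f1 n f] f1 degf lead n_pos by auto
  hence D: "(f1 - f) mod f = f1 - f" using degf by (intro mod_poly_less) simp
  have "0 = pcompose f1 (shift_poly r l) mod f" using dvd by simp
  also have "pcompose f1 (shift_poly r l) = f + ((f1 - f) + ?S (f1 - f) + ?S f)"
    by (simp add: pcompose_diff)
  also have "\<dots> mod f = (f1 - f) + ?S (f1 - f) mod f + ?S f mod f"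
    by (subst mod_add_self1) (simp only: poly_mod_add_left D)
  finally have eq: "f1 - f = - (?S f mod f) - ?S (f1 - f) mod f" by (simp add: algebra_simps)
  have R: "above l (int n) (?S f mod f)" by (intro above_mod above_shift_admissible f l r)
  have E: "above l (T + 1) (?S (f1 - f) mod f)" if "above l T (f1 - f)" for T
    by (intro above_mod above_substitution f l r that)
  have step: "above l (int n - int e) (f1 - f) \<Longrightarrow> above l (int n) (f1 - f)" for e
  proof (induction e)
    case (Suc e)
    have "above l (int n - int e) (?S (f1 - f) mod f)" using E[OF Suc.prems] by simp
    moreover have "above l (int n - int e) (?S f mod f)" using R by (rule above_mono) simp
    ultimately have "above l (int n - int e) (f1 - f)"
      by (subst eq) (simp add: above_diff above_uminus)
    thus ?case by (rule Suc.IH)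
  qed simp
  obtain T where "above l T (f1 - f)" using above_exists by blast
  hence "above l (int n - int (nat (int n - T))) (f1 - f)" by (rule above_mono) simp
  thus A: "above l (int n) (f1 - f)" by (rule step)
  have "(f1 - f) + ?S f mod f = - (?S (f1 - f) mod f)" 
    by (subst eq) simp
  thus "above l (int n + 1) ((f1 - f) + ?S f mod f)" using E[OF A] by (simp add: above_uminus)
qed

end

section \<open>The terms that reach the threshold\<close>

context insep_data
begin

text \<open>
  If \<open>phi l j + h\<close> is divisible by \<open>n\<close>, then \<open>h\<close> and \<open>phi l j\<close> have the same truncated valuation.
\<close>

lemma tval_compl_residue:
  assumes "phi l j = int n * k - int h" "trunc_val p \<nu> (phi l j) = j" "h \<le> n"
  shows "tval (n - h) = j" "m \<le> j \<Longrightarrow> p ^ m dvd h" "j \<le> \<nu>"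
proof -
  have "m \<le> tval h \<longleftrightarrow> m \<le> j" for m
  proof -
    have "int p ^ m dvd phi l j \<longleftrightarrow> int p ^ m dvd int h" if "m \<le> \<nu>"
    proof -
      have "int p ^ m dvd int n * k"
        using power_dvd_n that by (metis dvd_mult2 dvd_trans int_dvd_int_iff le_imp_power_dvd of_nat_power)
      thus ?thesis using assms(1) by (metis dvd_diff_right_iff)
    qed
    thus ?thesis using assms(2) le_tval_iff[of m h] le_trunc_val_iff[OF prime_p, of m \<nu> "phi l j"]
      by (metis int_dvd_int_iff of_nat_power)
  qed
  hence "tval h = j" by (meson order_antisym order_refl)
  thus "tval (n - h) = j" "m \<le> j \<Longrightarrow> p ^ m dvd h" "j \<le> \<nu>"
    using tval_compl[OF assms(3)] le_tval_iff[of m h] tval_le[of h] by auto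
qed

text \<open>
  The \<open>s\<close>-th binomial term of the monomial of degree \<open>n - i\<close> of \<open>f\<close>, under the substitution of
  \<open>X + r X\<^sup>l\<^sup>+\<^sup>1\<close> for \<open>X\<close>, has the exponent \<open>n - i + s l\<close>. Among the terms whose exponent has truncated
  valuation \<open>j\<close>, only those with \<open>s = p\<^sup>m\<close> and \<open>i \<equiv> b m\<close> modulo \<open>n\<close>, where \<open>phi l j = I m + p\<^sup>m l\<close>, can have
  weight exactly \<open>n + phi l j\<close>; the others are higher.
\<close>

lemma val_ge_nonleading:
  assumes f: "admissible f" and l: "1 \<le> l" and i: "i < n" and s: "0 < s"
    and q: "tval (n - i + s * l) = j"
    and A: "\<And>m. m \<le> j \<Longrightarrow> I m = A m * int n - int (b m)"
    and main: "\<And>m. m \<le> j \<Longrightarrow> phi l j = I m + int (p ^ m * l) \<Longrightarrow> (i, s) \<noteq> (b m mod n, p ^ m)"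
  shows "val_ge (phi l j + int i - int (s * l) + 1) (coeff f (n - i) * of_nat ((n - i) choose s))"
proof (cases "j < tval s")
  case True
  have x: "val_ge (if i = 0 then 0 else I (tval i) + int i) (coeff f (n - i))"
    using admissible_coeff[OF f, of "n - i"] i by (simp only: diff_diff_cancel less_imp_le)
  show ?thesis using phi_leading(2)[OF l i x s] True q by simp
next
  case False
  define m where "m = tval s"
  have m: "m \<le> j" using False by (simp add: m_def)
  have x: "val_ge (if i = 0 then 0 else I (tval i) + int i) (coeff f (n - i))"
    using admissible_coeff[OF f, of "n - i"] i by (simp only: diff_diff_cancel less_imp_le)
  have C: "val_ge (I m + int i) (coeff f (n - i) * of_nat ((n - i) choose s))"
    unfolding m_def by (rule val_ge_coeff_binomial[OF i x s])
  have "p ^ m \<le> s" unfolding m_def using tval_dvd s by (rule dvd_imp_le)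
  hence ps: "int (p ^ m * l) \<le> int (s * l)" by (metis mult_le_mono1 of_nat_le_iff)
  have le: "phi l j \<le> I m + int (p ^ m * l)" using m by (rule phi_le)
  show ?thesis
  proof (cases "phi l j < I m + int (s * l)")
    case True
    thus ?thesis using C by (auto elim: val_ge_mono)
  next
    case False
    with le ps have eq: "phi l j = I m + int (p ^ m * l)" "int (p ^ m * l) = int (s * l)" by linarith+
    hence "p ^ m * l = s * l" by (simp only: of_nat_eq_iff)
    hence sp: "s = p ^ m" using l by simp
    have "\<not> int n dvd I m + int i"
    proof
      assume "int n dvd I m + int i"
      moreover have "I m + int i = A m * int n + (int i - int (b m))" using A[OF m] by simp
      ultimately have "int n dvd int i - int (b m)" by (simp add: dvd_add_right_iff)
      hence "int i mod int n = int (b m) mod int n" by (simp add: mod_eq_dvd_iff)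
      hence "i = b m mod n" using i by (metis mod_less of_nat_eq_iff zmod_int)
      thus False using main[OF m eq(1)] sp by simp
    qed
    from val_ge_succ[OF C this] show ?thesis using eq(1) sp by simp
  qed
qed

text \<open>
  The coefficient that is left when the \<open>s\<close>-th binomial term of the monomial of degree \<open>n - i\<close> of \<open>f\<close>,
  under the substitution of \<open>X + r X\<^sup>l\<^sup>+\<^sup>1\<close> for \<open>X\<close>, is reduced by \<open>X\<^sup>n = - f(0)\<close>.
\<close>

definition leading_term :: "'a poly \<Rightarrow> nat \<Rightarrow> 'a \<Rightarrow> nat \<Rightarrow> nat \<Rightarrow> 'a" where
  "leading_term f l r i s = coeff f (n - i) * of_nat ((n - i) choose s) * r ^ s *
     (- coeff f 0) ^ ((n - i + s * l) div n)"

text \<open>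
  The coefficient of \<open>X\<^sup>n\<^sup>-\<^sup>h\<close> in \<open>f1 - f\<close>, modulo the power of the maximal ideal that corresponds to the
  next threshold. The index \<open>i = b m mod n\<close> is \<open>0\<close> for \<open>b m = n\<close>: in that case the contribution comes from
  the leading coefficient of \<open>f\<close>, since the constant term is not affected by the substitution.
\<close>

lemma perturbation_coeff:
  assumes f: "admissible f" and f1: "degree f1 = n" "lead_coeff f1 = 1"
    and l: "1 \<le> l" and r: "val_ge 0 r" and dvd: "f dvd pcompose f1 (shift_poly r l)"
    and Phi: "phi l j = int n * k - int h" and j: "trunc_val p \<nu> (phi l j) = j"
    and h: "1 \<le> h" "h \<le> n"
    and A: "\<And>m. m \<le> j \<Longrightarrow> I m = A m * int n - int (b m)"
    and S: "S = {m. m \<le> j \<and> phi l j = I m + int (p ^ m * l)}"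
  shows "val_ge (int n * (k + 1))
    (coeff (f1 - f) (n - h) + (\<Sum>m\<in>S. leading_term f l r (b m mod n) (p ^ m)))"
proof (rule val_ge_round_up)
  let ?Q = "pcompose f (shift_poly r l) - f"
  have n: "degree f = n" using f by (simp add: admissible_def)
  note tval = tval_compl_residue[OF Phi j h(2)]
  have thr: "int n + 1 + phi l j - int (n - h) = int n * k + 1" using Phi h by (simp add: of_nat_diff)
  define x where "x t s = coeff f t * of_nat (t choose s) * r ^ s" for t s
  define C where "C = - coeff f 0"
  define y where "y t s = (if (t + s * l) mod n = n - h then x t s * C ^ ((t + s * l) div n) else 0)"
    for t s
  have val_ge_C: "val_ge (int e * int n) (C ^ e)" for e
  proof -
    have "\<forall>i\<in>{1..n}. val_ge (I (tval i) + int i) (coeff f (n - i))"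
      using f by (simp add: admissible_def)
    moreover have "n \<in> {1..n}" using n_pos by simp
    ultimately have "val_ge (I (tval n) + int n) (coeff f (n - n))" by (rule bspec)
    hence "val_ge (int n) C" by (simp add: C_def I_top)
    thus ?thesis by (rule val_ge_power)
  qed
  have Q: "?Q mod f = (\<Sum>t\<le>n. \<Sum>s\<in>{1..t}. monom (x t s) (t + s * l) mod f)"
    unfolding pcompose_shift_poly_diff n x_def by (simp add: poly_mod_sum_left)
  have "above l (int n + 1) (monom (x t s) (t + s * l) mod f -
      monom (x t s * C ^ ((t + s * l) div n)) ((t + s * l) mod n))" if "s \<in> {1..t}" "t \<le> n" for t s
    unfolding C_def
  proof (rule monom_mod_admissible(1)[OF f l])
    have i: "n - t < n" using that by auto
    have c: "val_ge (if n - t = 0 then 0 else I (tval (n - t)) + int (n - t)) (coeff f t)"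
      using that by (intro admissible_coeff f) auto
    have "val_ge (phi l (tval (n - (n - t) + s * l)) + int (n - t) - int (s * l))
        (coeff f t * of_nat ((n - (n - t)) choose s))"
      using that by (intro phi_leading(1)[OF l i c]) auto
    hence "val_ge (int n + phi l (tval (t + s * l)) - int (t + s * l)) (coeff f t * of_nat (t choose s))"
      using that by (simp add: of_nat_diff algebra_simps)
    thus "val_ge (int n + phi l (tval (t + s * l)) - int (t + s * l)) (x t s)"
      unfolding x_def by (rule val_ge_mult_int) (rule val_ge_power_0[OF r])
  qed
  hence "val_ge (int n + 1 + phi l (tval (n - h)) - int (n - h))
      (coeff (monom (x t s) (t + s * l) mod f) (n - h) - y t s)" if "s \<in> {1..t}" "t \<le> n" for t s
    using that unfolding above_def y_def by (smt (verit) coeff_diff coeff_monom)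
  hence red: "val_ge (int n * k + 1) (coeff (monom (x t s) (t + s * l) mod f) (n - h) - y t s)"
    if "s \<in> {1..t}" "t \<le> n" for t s
    using that by (simp only: tval thr)
  have y0: "y t s = 0" if "t < s" for t s using that by (simp add: y_def x_def binomial_eq_0)
  have "coeff (?Q mod f) (n - h) - (\<Sum>t\<le>n. \<Sum>s\<in>{1..n}. y t s) =
      coeff (?Q mod f) (n - h) - (\<Sum>t\<le>n. \<Sum>s\<in>{1..t}. y t s)"
  proof -
    have "(\<Sum>s\<in>{1..n}. y t s) = (\<Sum>s\<in>{1..t}. y t s)" if "t \<le> n" for t
      using that by (intro sum.mono_neutral_right) (auto intro!: y0)
    thus ?thesis by simp
  qed
  also have "\<dots> = (\<Sum>t\<le>n. \<Sum>s\<in>{1..t}. coeff (monom (x t s) (t + s * l) mod f) (n - h) - y t s)"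
    unfolding Q by (simp add: coeff_sum sum_subtractf)
  also have "val_ge (int n * k + 1) \<dots>" by (intro val_ge_sum red) auto
  finally have 1: "val_ge (int n * k + 1)
      (coeff (?Q mod f) (n - h) - (\<Sum>t\<le>n. \<Sum>s\<in>{1..n}. y t s))" .
  define M where "M = (\<lambda>m. (n - b m mod n, p ^ m)) ` S"
  have inj: "inj_on (\<lambda>m. (n - b m mod n, p ^ m)) S" using p_ge_2 by (auto simp: inj_on_def)
  have Snu: "m \<le> \<nu>" if "m \<in> S" for m using that S tval(3) by auto
  have pn: "p ^ m \<le> n" if "m \<le> \<nu>" for m
    using dvd_imp_le[OF dvd_trans[OF le_imp_power_dvd[OF that] power_dvd_n] n_pos] .
  have M_sub: "M \<subseteq> {..n} \<times> {1..n}"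
    using pn Snu p_ge_2 by (auto simp: M_def Suc_le_eq)
  have "(\<Sum>t\<le>n. \<Sum>s\<in>{1..n}. y t s) = (\<Sum>(t, s)\<in>{..n} \<times> {1..n}. y t s)"
    by (rule sum.cartesian_product)
  also have "\<dots> = (\<Sum>(t, s)\<in>{..n} \<times> {1..n} - M. y t s) + (\<Sum>(t, s)\<in>M. y t s)"
    using M_sub by (intro sum.subset_diff) auto
  also have "(\<Sum>(t, s)\<in>M. y t s) = (\<Sum>m\<in>S. y (n - b m mod n) (p ^ m))"
    unfolding M_def by (subst sum.reindex[OF inj]) simp
  also have "\<dots> = (\<Sum>m\<in>S. leading_term f l r (b m mod n) (p ^ m))"
  proof (intro sum.cong refl)
    fix m assume "m \<in> S"
    hence m: "m \<le> j" "phi l j = I m + int (p ^ m * l)" using S by auto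
    have bn: "b m mod n \<le> n" using n_pos by (simp add: less_imp_le)
    have "int (n - b m mod n + p ^ m * l) - int (n - h) =
        int n * (k - A m) + (int (b m) - int (b m mod n))"
      using m(2) A[OF m(1)] Phi bn h(2) by (simp add: of_nat_diff algebra_simps)
    also have "int (b m) - int (b m mod n) = int n * int (b m div n)"
      by (metis add_diff_cancel_right' mult_div_mod_eq of_nat_add of_nat_mult)
    finally have "int n dvd int (n - b m mod n + p ^ m * l) - int (n - h)"
      by (simp flip: distrib_left)
    hence "int (n - b m mod n + p ^ m * l) mod int n = int (n - h) mod int n"
      by (simp only: mod_eq_dvd_iff)
    hence "(n - b m mod n + p ^ m * l) mod n = (n - h) mod n"
      unfolding zmod_int[symmetric] of_nat_eq_iff .
    also have "\<dots> = n - h" using h n_pos by simp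
    finally show "y (n - b m mod n) (p ^ m) = leading_term f l r (b m mod n) (p ^ m)"
      by (simp add: y_def leading_term_def x_def C_def)
  qed
  finally have 2: "(\<Sum>t\<le>n. \<Sum>s\<in>{1..n}. y t s) =
      (\<Sum>(t, s)\<in>{..n} \<times> {1..n} - M. y t s) + (\<Sum>m\<in>S. leading_term f l r (b m mod n) (p ^ m))" .
  have 3: "val_ge (int n * k + 1) (y t s)" if ts: "(t, s) \<in> {..n} \<times> {1..n} - M" for t s
  proof (cases "(t + s * l) mod n = n - h \<and> 0 < t")
    case False
    hence "y t s = 0" using that by (auto simp: y_def x_def binomial_eq_0)
    thus ?thesis by simp
  next
    case True
    define i where "i = n - t"
    have i: "i < n" "t = n - i" using True ts by (auto simp: i_def)
    have vbt: "tval (n - i + s * l) = j"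
      using tval(1) True i tval_cong[of "n - i + s * l" "n - h"] h n_pos by simp
    have "val_ge (phi l j + int i - int (s * l) + 1) (coeff f (n - i) * of_nat ((n - i) choose s))"
    proof (rule val_ge_nonleading[OF f l i(1) _ vbt A])
      fix m assume "m \<le> j" "phi l j = I m + int (p ^ m * l)"
      hence "m \<in> S" using S by simp
      thus "(i, s) \<noteq> (b m mod n, p ^ m)" using ts i by (auto simp: M_def)
    qed (use ts in auto)
    hence "val_ge (phi l j + int i - int (s * l) + 1) (x t s)"
      unfolding x_def i(2) by (rule val_ge_mult_int) (rule val_ge_power_0[OF r])
    from val_ge_mult[OF this val_ge_C]
    have "val_ge (phi l j + int i - int (s * l) + 1 + int ((t + s * l) div n) * int n) (y t s)"
      using True by (simp add: y_def)
    moreover have "t + s * l = (t + s * l) div n * n + (n - h)"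
      using div_mult_mod_eq[of "t + s * l" n] True by simp
    hence "int ((t + s * l) div n) * int n = int (t + s * l) - int (n - h)"
      by (metis add_diff_cancel_right' of_nat_add of_nat_mult)
    hence "phi l j + int i - int (s * l) + 1 + int ((t + s * l) div n) * int n = int n * k + 1"
      using Phi of_nat_diff[OF h(2), where 'a = int] of_nat_diff[of t n, where 'a = int] ts
      unfolding i_def of_nat_add by simp
    ultimately show ?thesis by (simp only:)
  qed
  have "val_ge (int n * k + 1) (\<Sum>(t, s)\<in>{..n} \<times> {1..n} - M. y t s)"
    using 3 by (intro val_ge_sum) (auto simp: case_prod_unfold)
  from val_ge_add[OF 1 this]
  have 4: "val_ge (int n * k + 1)
      (coeff (?Q mod f) (n - h) - (\<Sum>m\<in>S. leading_term f l r (b m mod n) (p ^ m)))"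
    by (simp add: 2 del: One_nat_def)
  have "above l (int n + 1) ((f1 - f) + ?Q mod f)"
    by (rule above_perturbation(2)[OF f f1 l r dvd])
  hence "val_ge (int n + 1 + phi l (tval (n - h)) - int (n - h)) (coeff ((f1 - f) + ?Q mod f) (n - h))"
    unfolding above_def by blast
  hence "val_ge (int n * k + 1) (coeff (f1 - f) (n - h) + coeff (?Q mod f) (n - h))"
    by (simp only: tval thr coeff_add)
  from val_ge_diff[OF this 4] show "val_ge (int n * k + 1) (coeff (f1 - f) (n - h) +
      (\<Sum>m\<in>S. leading_term f l r (b m mod n) (p ^ m)))" by (simp add: algebra_simps)
qed

lemma admissible_sign_coeff:
  assumes "admissible f" "1 \<le> b" "b \<le> n"
  shows "val_ge (I (tval b) + int b) ((-1) ^ b * coeff f (n - b))"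
proof -
  have "\<forall>i\<in>{1..n}. val_ge (I (tval i) + int i) (coeff f (n - i))"
    using assms by (simp add: admissible_def)
  hence "val_ge (I (tval b) + int b) (coeff f (n - b))" using assms by auto
  from val_ge_mult_int[OF this val_ge_power_0[of "-1" b]] show ?thesis by (simp add: mult.commute)
qed

text \<open>
  With \<open>c\<close> the coefficient of index \<open>b\<close>, the product \<open>(b / p\<^sup>m) c\<close> has valuation at least \<open>A\<close>, and
  \<open>(n / p\<^sup>m) c\<close> has valuation more than \<open>A\<close> unless \<open>b = n\<close>.
\<close>

lemma leading_coeff_bounds:
  assumes f: "admissible f" and m: "m \<le> \<nu>" and b: "1 \<le> b" "b \<le> n"
    and A: "I m = A * int n - int b" and \<beta>: "b = p ^ m * \<beta>" and w: "n = p ^ m * w"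
  shows "val_ge (int n * A) (of_nat \<beta> * ((-1) ^ b * coeff f (n - b)))"
    and "b < n \<Longrightarrow> val_ge (int n * (A + 1)) (of_nat w * ((-1) ^ b * coeff f (n - b)))"
proof -
  let ?c = "(-1) ^ b * coeff f (n - b)"
  have c: "val_ge (I (tval b) + int b) ?c" by (rule admissible_sign_coeff[OF f b])
  have p: "0 < p ^ m" using p_ge_2 by simp
  have mb: "m \<le> tval b" using m \<beta> by (simp add: le_tval_iff)
  have "p ^ m * p ^ (tval b - m) dvd p ^ m * \<beta>"
    using tval_dvd[of b] \<beta> mb by (simp flip: power_add)
  hence "p ^ (tval b - m) dvd \<beta>" by (simp only: nat_mult_dvd_cancel1[OF p])
  from I_shift_coeff[OF m this mb tval_le c]
  show "val_ge (int n * A) (of_nat \<beta> * ?c)" using A by (simp add: mult.commute)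
  show "val_ge (int n * (A + 1)) (of_nat w * ?c)" if "b < n"
  proof -
    have "val_ge (int b) ?c" using c I_nonneg[OF tval_le] by (auto elim: val_ge_mono)
    hence "val_ge (int b + 1) ?c" using that b by (intro val_ge_succ) (auto dest: zdvd_imp_le)
    moreover have "p ^ m * p ^ (\<nu> - m) dvd p ^ m * w"
      using power_dvd_n w m by (simp flip: power_add)
    hence "p ^ (\<nu> - m) dvd w" by (simp only: nat_mult_dvd_cancel1[OF p])
    ultimately have "val_ge (I m + (int b + 1)) (?c * of_nat w)"
      using m I_top by (intro I_shift_coeff[where q = \<nu>]) auto
    hence "val_ge (int n * A + 1) (?c * of_nat w)" using A by (simp add: mult.commute)
    from val_ge_round_up[OF this] show ?thesis by (simp add: mult.commute)
  qed
qed

text \<open>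
  In front of the coefficient of index \<open>b\<close>, and up to valuation \<open>A + 1\<close>, the binomial coefficients of
  the leading terms may be replaced by \<open>b / p\<^sup>m\<close>, up to sign.
\<close>

lemma binomial_leading:
  assumes f: "admissible f" and m: "m \<le> \<nu>" and b: "1 \<le> b" "b \<le> n"
    and A: "I m = A * int n - int b" and \<beta>: "b = p ^ m * \<beta>" and w: "n = p ^ m * w"
    and N: "N = (if b = n then int (n choose p ^ m) else - int ((n - b) choose p ^ m))"
  shows "val_ge (int n * (A + 1)) (of_int (N - int \<beta>) * ((-1) ^ b * coeff f (n - b)))"
proof -
  let ?c = "(-1) ^ b * coeff f (n - b)"
  note bounds = leading_coeff_bounds[OF f m b A \<beta> w]
  have p: "0 < p ^ m" using p_ge_2 by simp
  have *: "val_ge (int n * (A + 1)) (of_int (int p * int a * e) * ?c)"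
    if "val_ge (int n * A) (of_nat a * ?c)" for a e
  proof -
    have "val_ge (int n * A + int n) ((of_nat a * ?c) * of_nat p * of_int e)"
      by (rule val_ge_mult_int[OF val_ge_mult[OF that val_ge_p] val_ge_of_int])
    hence "val_ge (int n * (A + 1)) ((of_nat a * ?c) * of_nat p * of_int e)"
      by (simp only: distrib_left mult_1_right)
    thus ?thesis by (simp add: ac_simps)
  qed
  show ?thesis
  proof (cases "b = n")
    case True
    hence bw: "\<beta> = w" using \<beta> w nat_mult_eq_cancel1[OF p] by metis
    have "0 < w" using w n_pos by (cases w) auto
    from binomial_prime_power[OF prime_p this, of m] obtain e
      where "int ((w * p ^ m) choose (p ^ m)) = int w + int p * int w * e" by blast
    hence "N - int \<beta> = int p * int \<beta> * e" using N True w bw by (simp add: mult.commute[of w])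
    thus ?thesis using *[OF bounds(1)] by simp
  next
    case False
    hence bn: "b < n" using b by simp
    define a where "a = w - \<beta>"
    have "\<beta> < w" using bn \<beta> w nat_mult_less_cancel1[OF p] by metis
    hence a: "0 < a" "w = \<beta> + a" by (auto simp: a_def)
    have "n - b = a * p ^ m" using \<beta> w by (simp add: a_def algebra_simps)
    with binomial_prime_power[OF prime_p a(1), of m] obtain e
      where "int ((n - b) choose (p ^ m)) = int a + int p * int a * e" by metis
    hence N': "N - int \<beta> = - int w - int p * int a * e" using N False a by simp
    have "val_ge (int n * A) (of_nat w * ?c)" using bounds(2)[OF bn] n_pos by (auto elim: val_ge_mono)
    from val_ge_diff[OF this bounds(1)] have "val_ge (int n * A) (of_nat a * ?c)"
      by (simp add: a(2) algebra_simps)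
    from val_ge_diff[OF _ *[OF this], of "- (of_nat w * ?c)" e] bounds(2)[OF bn]
    show ?thesis unfolding N' by (simp add: algebra_simps)
  qed
qed

text \<open>
  Each of the three expressions for \<open>G\<close> is \<open>b / p\<^sup>m\<close> up to a multiple of \<open>n / p\<^sup>m\<close>, which is zero for
  \<open>b = n\<close>. So all three describe the same class, and the distinction of cases only selects a
  representative.
\<close>

lemma leading_term_value:
  assumes f: "admissible f" and m: "m \<le> \<nu>" and b: "1 \<le> b" "b \<le> n" and h: "1 \<le> h" "h \<le> n"
    and A: "I m = A * int n - int b"
    and \<beta>: "b = p ^ m * \<beta>" and w: "n = p ^ m * w" and \<eta>: "h = p ^ m * \<eta>"
    and e: "int e * int w = int l + int \<eta> - int \<beta>" and r: "val_ge 0 r"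
    and G: "G = (if b < h then int \<eta> + int l - int w else if b < n then int \<eta> + int l else int w)"
    and c: "c = (\<lambda>i. (-1) ^ i * coeff f (n - i))"
  shows "val_ge (int n * (A + int e + 1))
    ((-1) ^ h * leading_term f l r (b mod n) (p ^ m) +
     (-1) ^ (e + l) * of_int G * c n ^ e * c b * r ^ (p ^ m))"
proof -
  have p: "0 < p ^ m" using p_ge_2 by simp
  note bounds = leading_coeff_bounds[OF f m b A \<beta> w]
  define N where "N = (if b = n then int (n choose p ^ m) else - int ((n - b) choose p ^ m))"
  define \<epsilon> :: 'a where "\<epsilon> = (-1) ^ (h + b + (n + 1) * e)"
  have ne: "n * e + b = p ^ m * l + h"
  proof -
    have "e * w + \<beta> = l + \<eta>" using e by (simp flip: of_nat_mult of_nat_add)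
    hence "p ^ m * (e * w + \<beta>) = p ^ m * (l + \<eta>)" by simp
    thus ?thesis using \<beta> w \<eta> by (simp add: algebra_simps)
  qed
  have cn: "- coeff f 0 = (-1) ^ (n + 1) * c n" by (simp add: c flip: power_add mult_2)
  have lead: "(-1) ^ h * leading_term f l r (b mod n) (p ^ m) =
      - (\<epsilon> * of_int N * c b * c n ^ e * r ^ (p ^ m))"
  proof (cases "b = n")
    case True
    have pw: "((-1) ^ (n + 1) * c n) ^ (e + 1) = (-1) ^ ((n + 1) * (e + 1)) * (c n * c n ^ e)"
      by (subst power_mult_distrib) (simp only: power_mult[symmetric] power_Suc[of "c n"] Suc_eq_plus1[symmetric])
    have "n + p ^ m * l = (e + 1) * n + (n - h)"
      using ne True h by (simp add: mult.commute[of e n])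
    hence "(n + p ^ m * l) div n = e + 1" using h n_pos by (simp only: div_mult_self3) simp
    moreover have "coeff f n = 1" using f by (auto simp: admissible_def)
    ultimately have "leading_term f l r (b mod n) (p ^ m) =
        of_int N * r ^ p ^ m * ((-1) ^ (n + 1) * c n) ^ (e + 1)"
      using True by (simp add: leading_term_def N_def cn)
    also have "\<dots> = (-1) ^ ((n + 1) * (e + 1)) * of_int N * r ^ p ^ m * (c n * c n ^ e)"
      unfolding pw by (simp only: mult_minus_left mult_minus_right ac_simps)
    finally show ?thesis using True
      by (simp add: \<epsilon>_def power_add algebra_simps)
  next
    case False
    hence bn: "b < n" using b by simp
    have pw: "((-1) ^ (n + 1) * c n) ^ e = (-1) ^ ((n + 1) * e) * c n ^ e"
      by (simp only: power_mult_distrib power_mult[symmetric])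
    have "n - b + p ^ m * l = e * n + (n - h)" using ne bn h by (simp add: mult.commute)
    hence "(n - b + p ^ m * l) div n = e" using h n_pos by (simp only: div_mult_self3) simp
    moreover have "coeff f (n - b) = (-1) ^ b * c b" by (simp add: c flip: power_add mult_2)
    ultimately have "leading_term f l r (b mod n) (p ^ m) =
        - (((-1) ^ b * c b) * of_int N * r ^ p ^ m * ((-1) ^ (n + 1) * c n) ^ e)"
      using False bn by (simp add: leading_term_def N_def cn)
    also have "\<dots> = - ((-1) ^ b * (-1) ^ ((n + 1) * e) * c b * of_int N * r ^ p ^ m * c n ^ e)"
      unfolding pw by (simp only: mult_minus_left mult_minus_right ac_simps)
    finally show ?thesis by (simp add: \<epsilon>_def power_add algebra_simps)
  qed
  have sign: "val_ge 0 ((-1) ^ i)" for i by (rule val_ge_power_0) simp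
  have 1: "val_ge (int n * (A + 1)) (of_int (N - int \<beta>) * c b)"
    using binomial_leading[OF f m b A \<beta> w N_def] by (simp add: c)
  have 2: "val_ge (int n * (A + 1)) (of_int (G - int \<beta>) * c b)"
  proof (cases "b = n")
    case True
    hence "\<beta> = w" using \<beta> w nat_mult_eq_cancel1[OF p] by metis
    thus ?thesis using G True h by simp
  next
    case False
    hence bn: "b < n" using b by simp
    define d where "d = int e - (if b < h then 1 else 0)"
    have "G - int \<beta> = d * int w" using G e bn by (simp add: d_def algebra_simps)
    moreover have "val_ge (int n * (A + 1)) ((of_nat w * c b) * of_int d)"
      using bounds(2)[OF bn] by (intro val_ge_mult_int[OF _ val_ge_of_int]) (simp add: c)
    ultimately show ?thesis by (simp add: ac_simps)
  qed
  \<comment> \<open>The two signs agree unless \<open>p = 2\<close>, in which case they agree modulo \<open>p\<close>.\<close>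
  have 3: "val_ge (int n * (A + 1)) (((-1) ^ (e + l) - \<epsilon>) * (of_nat \<beta> * c b))"
  proof -
    have par: "even (h + b + (n + 1) * e) \<longleftrightarrow> even (p ^ m * l + e)"
    proof -
      have "h + b + (n + 1) * e + p ^ m * l = 2 * (b + n * e) + e"
        using ne by (simp add: algebra_simps)
      hence "even (h + b + (n + 1) * e + p ^ m * l) \<longleftrightarrow> even e"
        by (simp only: even_add even_mult_iff) simp
      thus ?thesis by (simp only: even_add) blast
    qed
    show ?thesis
    proof (cases "\<epsilon> = (-1) ^ (e + l)")
      case False
      have "p = 2"
      proof (rule ccontr)
        assume "p \<noteq> 2"
        hence "odd p" using prime_odd_nat[OF prime_p] p_ge_2 by simp
        hence "even (h + b + (n + 1) * e) \<longleftrightarrow> even (e + l)" 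
using par by (simp only: even_add even_mult_iff even_power) blast
        hence "\<epsilon> = (-1) ^ (e + l)" unfolding \<epsilon>_def by (simp only: minus_one_power_iff)
        with False show False by simp
      qed
      have two: "val_ge (int n) (1 - - 1)" "val_ge (int n) (- 1 - 1)"
        using val_ge_p val_ge_diff[of "int n" 0 2] \<open>p = 2\<close> by simp_all
      have "\<epsilon> = 1 \<or> \<epsilon> = -1" "(-1) ^ (e + l) = (1 :: 'a) \<or> (-1) ^ (e + l) = (-1 :: 'a)"
        unfolding \<epsilon>_def minus_one_power_iff by presburger+
      hence "val_ge (int n) ((-1) ^ (e + l) - \<epsilon>)"
        by (elim disjE) (simp_all only: two diff_self val_ge_0)
      moreover have "c b = (-1) ^ b * coeff f (n - b)" by (simp add: c)
      ultimately show ?thesis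
        using val_ge_mult[OF _ bounds(1)] by (simp only: distrib_left mult_1_right add.commute)
    qed simp
  qed
  have "val_ge (int n * (A + 1)) (((-1) ^ (e + l) - \<epsilon>) * (of_nat \<beta> * c b) +
      (of_int (G - int \<beta>) * c b) * (-1) ^ (e + l) - (of_int (N - int \<beta>) * c b) * \<epsilon>)"
    using val_ge_mult_int[OF 1 sign, of "h + b + (n + 1) * e"]
    by (intro val_ge_diff val_ge_add 3 val_ge_mult_int[OF 2 sign]) (simp add: \<epsilon>_def)
  also have "((-1) ^ (e + l) - \<epsilon>) * (of_nat \<beta> * c b) +
      (of_int (G - int \<beta>) * c b) * (-1) ^ (e + l) - (of_int (N - int \<beta>) * c b) * \<epsilon> =
      (-1) ^ (e + l) * of_int G * c b - \<epsilon> * of_int N * c b"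
    by (simp add: algebra_simps)
  finally have "val_ge (int n * (A + 1)) ((-1) ^ (e + l) * of_int G * c b - \<epsilon> * of_int N * c b)" .
  moreover have "val_ge (int e * int n) (c n ^ e)"
    using admissible_sign_coeff[OF f, of n] n_pos I_top by (intro val_ge_power) (simp add: c)
  ultimately have "val_ge (int n * (A + 1) + int e * int n)
      (((-1) ^ (e + l) * of_int G * c b - \<epsilon> * of_int N * c b) * c n ^ e)" by (rule val_ge_mult)
  hence "val_ge (int n * (A + int e + 1))
      (((-1) ^ (e + l) * of_int G * c b - \<epsilon> * of_int N * c b) * c n ^ e * r ^ (p ^ m))"
    by (intro val_ge_mult_int[OF _ val_ge_power_0[OF r]]) (simp add: algebra_simps)
  moreover have "(x * g * y - z * g' * y) * w * q = - (z * g' * y * w * q) + x * g * w * y * q"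
    for x y z w g g' q :: 'a by (simp add: algebra_simps)
  ultimately show ?thesis unfolding lead by simp
qed

end

section \<open>Minimal polynomials of uniformizers\<close>

text \<open>
  A totally ramified extension of degree \<open>n\<close>. The assumption on ramification says that \<open>n v\<^sub>K\<close> is the
  restriction of \<open>v\<^sub>L\<close>.
\<close>

locale tot_ramified_ext = scaled_valuation vK n + L: scaled_valuation vL "Suc 0"
  for vK :: "'k::field \<Rightarrow> ereal" and n and vL :: "'l::field \<Rightarrow> ereal" +
  fixes \<iota> :: "'k \<Rightarrow> 'l"
  assumes emb: "field_embedding \<iota>" and deg: "field_degree \<iota> = n"
    and ram: "totally_ramified vK vL \<iota>"
begin

lemma iota_1 [simp]: "\<iota> 1 = 1" and iota_add: "\<iota> (x + y) = \<iota> x + \<iota> y"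
  and iota_mult: "\<iota> (x * y) = \<iota> x * \<iota> y"
  using emb by (auto simp: field_embedding_def)

lemma iota_0 [simp]: "\<iota> 0 = 0" using iota_add[of 0 0] by (metis add.right_neutral add_cancel_left_right)

lemma iota_power: "\<iota> (x ^ i) = \<iota> x ^ i" by (induction i) (simp_all add: iota_mult)

lemma iota_of_nat: "\<iota> (of_nat i) = of_nat i" by (induction i) (simp_all add: iota_add)

lemma L_val_ge_iota [simp]: "L.val_ge T (\<iota> x) \<longleftrightarrow> val_ge T x"
  using ram deg by (simp add: L.val_ge_def val_ge_def totally_ramified_def flip: one_ereal_def zero_ereal_def)

lemma L_val_ge_iff: "L.val_ge T x \<longleftrightarrow> ereal (of_int T) \<le> vL x"
  by (simp add: L.val_ge_def flip: one_ereal_def zero_ereal_def)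

text \<open>
  The value at \<open>x\<close> of a polynomial over the base field.
\<close>

definition eval_at :: "'l \<Rightarrow> 'k poly \<Rightarrow> 'l" where "eval_at x q = poly (map_poly \<iota> q) x"

lemma eval_at_0 [simp]: "eval_at x 0 = 0" by (simp add: eval_at_def)

lemma eval_at_pCons [simp]: "eval_at x (pCons a q) = \<iota> a + x * eval_at x q"
  by (simp add: eval_at_def map_poly_pCons)

lemma eval_at_add: "eval_at x (p + q) = eval_at x p + eval_at x q"
  by (induction p q rule: poly_induct2) (simp_all add: iota_add algebra_simps)

lemma eval_at_uminus: "eval_at x (- q) = - eval_at x q"
  using eval_at_add[of x q "- q"] by (simp add: eq_neg_iff_add_eq_0 add.commute)

lemma eval_at_diff: "eval_at x (p - q) = eval_at x p - eval_at x q"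
  using eval_at_add[of x p "- q"] by (simp add: eval_at_uminus)

lemma eval_at_sum: "eval_at x (\<Sum>i\<in>A. f i) = (\<Sum>i\<in>A. eval_at x (f i))"
  by (induction A rule: infinite_finite_induct) (simp_all add: eval_at_add)

lemma eval_at_smult: "eval_at x (smult a q) = \<iota> a * eval_at x q"
  by (induction q) (simp_all add: iota_mult algebra_simps)

lemma eval_at_mult: "eval_at x (p * q) = eval_at x p * eval_at x q"
  by (induction p) (simp_all add: eval_at_add eval_at_smult algebra_simps)

lemma eval_at_monom: "eval_at x (monom a t) = \<iota> a * x ^ t"
  by (induction t) (simp_all add: monom_0 monom_Suc)

lemma eval_at_pcompose: "eval_at x (pcompose p q) = eval_at (eval_at x q) p"
  by (induction p) (simp_all add: pcompose_pCons eval_at_add eval_at_mult)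

lemma eval_at_shift_poly: "eval_at x (shift_poly r l) = x + \<iota> r * x ^ (l + 1)"
  by (simp add: shift_poly_def eval_at_add eval_at_monom)

lemma eval_at_altdef:
  assumes "degree q \<le> N" shows "eval_at x q = (\<Sum>i\<le>N. \<iota> (coeff q i) * x ^ i)"
  using poly_as_sum_of_monoms'[OF assms] eval_at_sum[of x "\<lambda>i. monom (coeff q i) i" "{..N}"]
  by (simp add: eval_at_monom)

lemma val_ge_eval_at:
  assumes "\<And>i. val_ge 0 (coeff q i)" "L.val_ge 0 x" shows "L.val_ge 0 (eval_at x q)"
  unfolding eval_at_altdef[OF order_refl]
  by (intro L.val_ge_sum L.val_ge_mult_int[OF _ L.val_ge_power_0[OF assms(2)]]) (simp add: assms)

lemma val_ge_eval_at_diff: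
  assumes "\<And>i. val_ge 0 (coeff q i)" "L.val_ge 0 x" "L.val_ge 0 y" "L.val_ge T (x - y)"
  shows "L.val_ge T (eval_at x q - eval_at y q)"
  using assms(1)
proof (induction q)
  case (pCons a q)
  have q: "val_ge 0 (coeff q i)" for i using pCons.prems[of "Suc i"] by simp
  have "eval_at x (pCons a q) - eval_at y (pCons a q) = (eval_at x q - eval_at y q) * x + (x - y) * eval_at y q"
    by (simp add: algebra_simps)
  moreover have "L.val_ge T ((eval_at x q - eval_at y q) * x)" using L.val_ge_mult_int[OF pCons.IH[OF q] assms(2)] .
  moreover have "L.val_ge T ((x - y) * eval_at y q)" using L.val_ge_mult_int[OF assms(4) val_ge_eval_at[OF q assms(3)]] .
  ultimately show ?case using L.val_ge_add by metis
qed simp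

lemma uniformizer_L: assumes "uniformizer vL \<pi>"
  shows "L.val_ge 1 \<pi>" "L.val_ge 0 \<pi>" "\<pi> \<noteq> 0" "vL (\<pi> ^ i) = ereal (real i)"
proof -
  have v: "vL \<pi> = 1" using assms by (simp add: uniformizer_def)
  show "L.val_ge 1 \<pi>" "L.val_ge 0 \<pi>" by (simp_all add: L_val_ge_iff v)
  show "\<pi> \<noteq> 0" using v by auto
  show "vL (\<pi> ^ i) = ereal (real i)"
    by (induction i) (simp_all add: L.v_mult v one_ereal_def zero_ereal_def)
qed

text \<open>
  The terms of a polynomial of degree less than \<open>n\<close>, evaluated at a uniformizer, have valuations that
  are distinct modulo \<open>n\<close>.
\<close>

lemma coeff_bound_of_eval_at:
  assumes \<pi>: "uniformizer vL \<pi>" and q: "degree q < n" "L.val_ge T (eval_at \<pi> q)"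
  shows "val_ge (T - int i) (coeff q i)"
proof (cases "i < n")
  case True
  define x where "x i = \<iota> (coeff q i) * \<pi> ^ i" for i
  have vx: "vL (x i) = ereal (of_int (int n * z + int i))" if "vK (coeff q i) = ereal (of_int z)" for i z
    using that ram deg by (simp add: x_def L.v_mult uniformizer_L[OF \<pi>] totally_ramified_def)
  have "eval_at \<pi> q = (\<Sum>i<n. x i)"
    using eval_at_altdef[of q "n - 1"] q(1) n_pos by (simp add: x_def lessThan_Suc_atMost[symmetric])
  hence "L.val_ge T (\<Sum>i<n. x i)" using q(2) by simp
  hence "L.val_ge T (x i)"
  proof (rule L.val_ge_sum_distinct[rotated])
    fix i j assume ij: "i \<in> {..<n}" "j \<in> {..<n}" "i \<noteq> j" "x i \<noteq> 0"
    hence "coeff q i \<noteq> 0" by (auto simp: x_def)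
    then obtain z :: int where z: "vK (coeff q i) = ereal (of_int z)" using v_nonzero by blast
    show "vL (x i) \<noteq> vL (x j)"
    proof (cases "coeff q j = 0")
      case True
      thus ?thesis using vx[OF z] by (simp add: x_def)
    next
      case False
      then obtain w :: int where w: "vK (coeff q j) = ereal (of_int w)" using v_nonzero by blast
      have "int n * z + int i \<noteq> int n * w + int j"
      proof
        assume "int n * z + int i = int n * w + int j"
        hence "(int n * z + int i) mod int n = (int n * w + int j) mod int n" by simp
        thus False using ij by simp
      qed
      thus ?thesis using vx[OF z] vx[OF w] by (simp only: ereal.inject of_int_eq_iff not_False_eq_True)
    qed
  qed (use True in auto)
  show ?thesis
  proof (cases "coeff q i = 0")
    case False
    then obtain z :: int where z: "vK (coeff q i) = ereal (of_int z)" using v_nonzero by blast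
    have "T \<le> int n * z + int i"
      using \<open>L.val_ge T (x i)\<close> unfolding L_val_ge_iff vx[OF z] by (simp only: ereal_less_eq(3) of_int_le_iff)
    thus ?thesis using z by (auto simp: val_ge_iff)
  qed simp
next
  case False
  thus ?thesis using q(1) by (simp add: coeff_eq_0)
qed

lemma eval_at_eq_0_imp: "uniformizer vL \<pi> \<Longrightarrow> degree q < n \<Longrightarrow> eval_at \<pi> q = 0 \<Longrightarrow> q = 0"
proof -
  assume \<pi>: "uniformizer vL \<pi>" and q: "degree q < n" "eval_at \<pi> q = 0"
  have "coeff q i = 0" for i
  proof (rule val_ge_all_imp_0)
    fix T show "val_ge T (coeff q i)" using coeff_bound_of_eval_at[OF \<pi> q(1), of "T + int i" i] q(2) by simp
  qed
  thus "q = 0" by (simp add: poly_eq_iff)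
qed

text \<open>
  The powers \<open>1, \<pi>, \<dots>, \<pi>\<^sup>n\<^sup>-\<^sup>1\<close> of a uniformizer are independent over the base field, hence a basis.
\<close>

lemma eval_at_surj:
  assumes \<pi>: "uniformizer vL \<pi>"
  obtains q where "degree q < n" "y = eval_at \<pi> q"
proof -
  interpret V: vector_space "\<lambda>a x. \<iota> a * x"
    by unfold_locales (simp_all add: iota_add iota_mult algebra_simps)
  define B where "B = (\<lambda>i. \<pi> ^ i) ` {..<n}"
  define P where "P u = (\<Sum>i<n. monom (u (\<pi> ^ i)) i)" for u :: "'l \<Rightarrow> 'k"
  have coeffP: "coeff (P u) i = (if i < n then u (\<pi> ^ i) else 0)" for u i
    by (simp add: P_def coeff_sum)
  have degP: "degree (P u) < n" for u
    using n_pos by (intro degree_lessI) (auto simp: coeffP)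
  have inj: "inj_on (\<lambda>i. \<pi> ^ i) {..<n}"
    by (rule inj_onI) (metis uniformizer_L(4)[OF \<pi>] ereal.inject of_nat_eq_iff)
  have evP: "eval_at \<pi> (P u) = (\<Sum>x\<in>B. \<iota> (u x) * x)" for u
    unfolding B_def by (subst sum.reindex[OF inj]) (simp add: P_def eval_at_sum eval_at_monom)
  have indep: "\<not> V.dependent B"
  proof (rule V.independent_if_scalars_zero)
    fix f x assume f: "(\<Sum>x\<in>B. \<iota> (f x) * x) = 0" "x \<in> B"
    hence "P f = 0" using eval_at_eq_0_imp[OF \<pi> degP[of f]] evP by simp
    moreover obtain i where "i < n" "x = \<pi> ^ i" using f(2) by (auto simp: B_def)
    ultimately show "f x = 0" using coeffP[of f i] by simp
  qed (simp add: B_def)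
  have cardB: "card B = n" unfolding B_def by (simp add: card_image[OF inj])
  obtain B' where "B' \<subseteq> UNIV" "\<not> V.dependent B'"
    and B': "UNIV \<subseteq> V.span B'" "card B' = V.dim (UNIV :: 'l set)"
    by (rule V.basis_exists)
  have cardB': "card B' = n" using B'(2) deg by (simp add: field_degree_def)
  hence finB': "finite B'" using n_pos card.infinite by fastforce
  have "y \<in> V.span B"
  proof (rule ccontr)
    assume y: "y \<notin> V.span B"
    hence "\<not> V.dependent (insert y B)" using indep by (rule V.independent_insertI)
    hence "card (insert y B) \<le> card B'" using V.independent_span_bound[OF finB'] B'(1) by blast
    moreover have "y \<notin> B" using y V.span_base by blast
    moreover have "finite B" by (simp add: B_def)
    ultimately show False using cardB cardB' by simp
  qed
  then obtain u where "y = (\<Sum>x\<in>B. \<iota> (u x) * x)"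
    using V.span_finite[of B] by (auto simp: B_def)
  with that[OF degP] evP show thesis by metis
qed

text \<open>
  The residue fields of both fields coincide.
\<close>

lemma residue_representative:
  assumes "uniformizer vL \<pi>" "L.val_ge 0 y"
  obtains r where "val_ge 0 r" "L.val_ge 1 (y - \<iota> r)"
proof -
  obtain q where q: "degree q < n" "y = eval_at \<pi> q" using eval_at_surj[OF assms(1)] .
  have c: "val_ge (- int i) (coeff q i)" for i
    using coeff_bound_of_eval_at[OF assms(1) q(1), of 0 i] assms(2) q(2) by simp
  have c0: "val_ge 0 (coeff q i)" for i
  proof (cases "i = 0 \<or> n \<le> i")
    case True
    thus ?thesis using c[of 0] q(1) by (auto simp: coeff_eq_0)
  next
    case False
    hence "int n * (-1) + 1 \<le> - int i" by simp
    with c have "val_ge (int n * (-1) + 1) (coeff q i)" by (rule val_ge_mono)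
    from val_ge_round_up[OF this] show ?thesis by simp
  qed
  obtain a q' where aq: "q = pCons a q'" by (cases q)
  have "val_ge 0 (coeff q' i)" for i using c0[of "Suc i"] aq by simp
  hence "L.val_ge 0 (eval_at \<pi> q')" using uniformizer_L(2)[OF assms(1)] by (rule val_ge_eval_at)
  from L.val_ge_mult_int[OF uniformizer_L(1)[OF assms(1)] this]
  have "L.val_ge 1 (y - \<iota> a)" using q aq by simp
  moreover have "val_ge 0 a" using c0[of 0] aq by simp
  ultimately show thesis using that by blast
qed

abbreviation mp :: "'l \<Rightarrow> 'k poly" where "mp \<equiv> min_poly \<iota>"

lemma min_poly_eqI:
  assumes \<pi>: "uniformizer vL \<pi>" and f: "degree f = n" "lead_coeff f = 1" "eval_at \<pi> f = 0"
  shows "mp \<pi> = f"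
  unfolding min_poly_def
proof (rule the_equality)
  have small: "n \<le> degree g" if "g \<noteq> 0" "poly (map_poly \<iota> g) \<pi> = 0" for g
    using eval_at_eq_0_imp[OF \<pi>, of g] that unfolding eval_at_def by (meson not_le)
  show "is_min_poly \<iota> \<pi> f"
    unfolding is_min_poly_def using f small by (auto simp: eval_at_def)
  fix g assume g: "is_min_poly \<iota> \<pi> g"
  have "f \<noteq> 0" using f by auto
  with f g have "degree g \<le> n" by (auto simp: is_min_poly_def eval_at_def)
  moreover have "g \<noteq> 0" using g by (auto simp: is_min_poly_def)
  ultimately have dg: "degree g = n" using g small[of g] by (auto simp: is_min_poly_def)
  have "degree (g - f) < n"
    using eq_zero_or_degree_less[of "g - f" n] degree_diff_le[of g n f] f dg g n_pos
    by (auto simp: is_min_poly_def)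
  moreover have "eval_at \<pi> (g - f) = 0" using f g unfolding eval_at_diff by (simp add: is_min_poly_def eval_at_def)
  ultimately show "g = f" using eval_at_eq_0_imp[OF \<pi>, of "g - f"] by simp
qed

lemma min_poly_uniformizer:
  assumes \<pi>: "uniformizer vL \<pi>"
  shows "degree (mp \<pi>) = n" "lead_coeff (mp \<pi>) = 1" "eval_at \<pi> (mp \<pi>) = 0"
proof -
  obtain q where q: "degree q < n" "\<pi> ^ n = eval_at \<pi> q" using eval_at_surj[OF \<pi>] .
  let ?f = "monom 1 n - q"
  have "degree ?f = n" using degree_add_eq_left[of "- q" "monom 1 n"] q by (simp add: degree_monom_eq)
  moreover from this have "lead_coeff ?f = 1" using q by (simp add: coeff_eq_0)
  moreover have "eval_at \<pi> ?f = 0" using q by (simp add: eval_at_diff eval_at_monom)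
  moreover from calculation have "mp \<pi> = ?f" by (intro min_poly_eqI[OF \<pi>])
  ultimately show "degree (mp \<pi>) = n" "lead_coeff (mp \<pi>) = 1" "eval_at \<pi> (mp \<pi>) = 0" by auto
qed

lemma min_poly_dvd:
  assumes \<pi>: "uniformizer vL \<pi>" and g: "eval_at \<pi> g = 0"
  shows "mp \<pi> dvd g"
proof -
  note f = min_poly_uniformizer[OF \<pi>]
  have "eval_at \<pi> g = eval_at \<pi> (g div mp \<pi> * mp \<pi> + g mod mp \<pi>)"
    by (simp only: div_mult_mod_eq)
  also have "\<dots> = eval_at \<pi> (g div mp \<pi>) * eval_at \<pi> (mp \<pi>) + eval_at \<pi> (g mod mp \<pi>)"
    by (simp only: eval_at_mult eval_at_add)
  finally have "eval_at \<pi> g = \<dots>" .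
  hence "eval_at \<pi> (g mod mp \<pi>) = 0" using f g by simp
  moreover have "mp \<pi> \<noteq> 0" using f(2) by auto
  hence "degree (g mod mp \<pi>) < n"
    using degree_mod_less[of "mp \<pi>" g] n_pos unfolding f(1) by fastforce
  ultimately have "g mod mp \<pi> = 0" by (intro eval_at_eq_0_imp[OF \<pi>])
  thus ?thesis by (simp only: dvd_eq_mod_eq_0)
qed

lemma min_poly_coeff_eq:
  assumes "uniformizer vL \<pi>"
  shows "min_poly_coeff \<iota> \<pi> h = (-1) ^ h * coeff (mp \<pi>) (n - h)"
  by (simp add: min_poly_coeff_def min_poly_uniformizer(1)[OF assms])

lemma min_poly_eisenstein:
  assumes \<pi>: "uniformizer vL \<pi>"
  shows "t < n \<Longrightarrow> val_ge (int n - int t) (coeff (mp \<pi>) t)" "val_ge 0 (coeff (mp \<pi>) t)"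
    "\<not> val_ge (int n + 1) (coeff (mp \<pi>) 0)"
proof -
  note f = min_poly_uniformizer[OF \<pi>]
  let ?q = "mp \<pi> - monom 1 n"
  have cf: "coeff ?q t = (if t = n then 0 else coeff (mp \<pi>) t)" for t
    using f(2) unfolding f(1) by simp
  have "degree ?q < n"
  proof -
    have "degree ?q \<le> n" by (intro degree_diff_le) (simp_all add: f(1) degree_monom_eq)
    moreover have "coeff ?q n = 0" unfolding cf by simp
    ultimately show ?thesis using eq_zero_or_degree_less[of ?q n] n_pos by auto
  qed
  have evq: "eval_at \<pi> ?q = - (\<pi> ^ n)" by (simp add: eval_at_diff eval_at_monom f(3))
  have "L.val_ge (int n) (eval_at \<pi> ?q)" by (simp add: evq L_val_ge_iff uniformizer_L[OF \<pi>])
  hence "val_ge (int n - int t) (coeff ?q t)" for t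
    by (rule coeff_bound_of_eval_at[OF \<pi> \<open>degree ?q < n\<close>])
  hence *: "val_ge (int n - int t) (coeff (mp \<pi>) t)" if "t < n" for t
    using that unfolding cf by (metis less_irrefl)
  thus "t < n \<Longrightarrow> val_ge (int n - int t) (coeff (mp \<pi>) t)" .
  show "val_ge 0 (coeff (mp \<pi>) t)"
  proof (cases t n rule: linorder_cases)
    case less
    show ?thesis by (rule val_ge_mono[OF *[OF less]]) (use less in simp)
  next
    case equal
    thus ?thesis using f(2) unfolding f(1) by simp
  next
    case greater
    hence "coeff (mp \<pi>) t = 0" using f(1) by (intro coeff_eq_0) simp
    thus ?thesis by simp
  qed
  show "\<not> val_ge (int n + 1) (coeff (mp \<pi>) 0)"
  proof
    assume 0: "val_ge (int n + 1) (coeff (mp \<pi>) 0)"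
    have c: "val_ge (int n + 1 - int t) (coeff ?q t)" for t
    proof (cases "t < n")
      case True
      hence q: "coeff ?q t = coeff (mp \<pi>) t" unfolding cf by simp
      have "val_ge (int n + 1 - int t) (coeff (mp \<pi>) t)"
      proof (cases "t = 0")
        case False
        hence "\<not> int n dvd int n - int t"
          using True zdvd_not_zless[of "int n - int t" "int n"] by simp
        from val_ge_succ[OF *[OF True] this] show ?thesis by (simp only: diff_add_eq)
      qed (use 0 in simp)
      thus ?thesis unfolding q .
    next
      case False
      with \<open>degree ?q < n\<close> have "coeff ?q t = 0" by (intro coeff_eq_0) simp
      thus ?thesis by (simp only: val_ge_0)
    qed
    have "L.val_ge (int n + 1) (\<iota> (coeff ?q t) * \<pi> ^ t)" for t
    proof -
      have "L.val_ge (int t) (\<pi> ^ t)" by (simp add: L_val_ge_iff uniformizer_L[OF \<pi>])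
      with c have "L.val_ge (int n + 1 - int t + int t) (\<iota> (coeff ?q t) * \<pi> ^ t)"
        by (intro L.val_ge_mult) (simp_all only: L_val_ge_iota)
      thus ?thesis by (simp only: diff_add_cancel)
    qed
    hence "L.val_ge (int n + 1) (\<Sum>t\<le>n. \<iota> (coeff ?q t) * \<pi> ^ t)" by (intro L.val_ge_sum)
    hence "L.val_ge (int n + 1) (eval_at \<pi> ?q)" 
      using eval_at_altdef[of ?q n \<pi>] \<open>degree ?q < n\<close> by (simp only: less_imp_le)
    thus False unfolding evq by (simp add: L_val_ge_iff uniformizer_L[OF \<pi>])
  qed
qed

lemma min_poly_Aut:
  assumes \<sigma>: "\<sigma> \<in> field_Aut \<iota>" and \<pi>: "uniformizer vL \<pi>" "uniformizer vL (\<sigma> \<pi>)"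
  shows "mp (\<sigma> \<pi>) = mp \<pi>"
proof -
  have \<sigma>_hom: "\<sigma> (x + y) = \<sigma> x + \<sigma> y" "\<sigma> (x * y) = \<sigma> x * \<sigma> y" "\<sigma> (\<iota> a) = \<iota> a" for x y a
    using \<sigma> by (auto simp: field_Aut_def field_embedding_def)
  have \<sigma>0: "\<sigma> 0 = 0" using \<sigma>_hom(3)[of 0] by simp
  have eval_at: "eval_at (\<sigma> x) q = \<sigma> (eval_at x q)" for x q
    by (induction q) (simp_all add: \<sigma>_hom \<sigma>0)
  show ?thesis using min_poly_uniformizer[OF \<pi>(1)] by (intro min_poly_eqI \<pi>) (simp_all add: eval_at \<sigma>0)
qed

end

section \<open>Changing the uniformizer\<close>

text \<open>
  A totally ramified extension together with integers \<open>I\<close> that have the properties of its indices of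
  inseparability.
\<close>

locale insep_ext = tot_ramified_ext vK n vL \<iota> + insep_data vK n p \<nu> I
  for vK :: "'k::field \<Rightarrow> ereal" and n and vL :: "'l::field \<Rightarrow> ereal" and \<iota> p \<nu> I
begin

lemma L_val_ge_cong_uniformizer:
  assumes "uniformizer vL \<pi>" "L.val_ge 2 (y - \<pi>)" shows "uniformizer vL y"
proof -
  have v: "vL \<pi> = ereal (of_int 1)" using assms(1) by (simp add: uniformizer_def one_ereal_def)
  have \<pi>1: "L.val_ge 1 \<pi>" and \<pi>2: "\<not> L.val_ge 2 \<pi>" unfolding L_val_ge_iff v by simp_all
  have y1: "L.val_ge 1 y" using L.val_ge_add[OF \<pi>1 L.val_ge_mono[OF assms(2)]] by simp
  have y2: "\<not> L.val_ge 2 y" using L.val_ge_diff[OF _ assms(2), of y] \<pi>2 by auto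
  hence "y \<noteq> 0" by auto
  then obtain z :: int where z: "vL y = ereal (of_int z)" using L.v_nonzero by blast
  hence "z = 1" using y1 y2 by (auto simp: L_val_ge_iff)
  thus ?thesis using z by (simp add: uniformizer_def one_ereal_def)
qed

lemma L_val_ge_uniformizer_power: "uniformizer vL \<pi> \<Longrightarrow> L.val_ge (int i) (\<pi> ^ i)"
  by (simp add: L_val_ge_iff uniformizer_L)

lemma uniformizer_step:
  assumes "uniformizer vL \<pi>" "1 \<le> l" "val_ge 0 r"
  shows "uniformizer vL (\<pi> + \<iota> r * \<pi> ^ (l + 1))"
proof (rule L_val_ge_cong_uniformizer[OF assms(1)])
  have "L.val_ge (0 + int (l + 1)) (\<iota> r * \<pi> ^ (l + 1))"
    using assms by (intro L.val_ge_mult L_val_ge_uniformizer_power) simp_all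
  thus "L.val_ge 2 (\<pi> + \<iota> r * \<pi> ^ (l + 1) - \<pi>)" using assms(2) by (auto elim: L.val_ge_mono)
qed

lemma min_poly_step_dvd:
  assumes "uniformizer vL \<pi>" "1 \<le> l" "val_ge 0 r"
  shows "mp \<pi> dvd pcompose (mp (\<pi> + \<iota> r * \<pi> ^ (l + 1))) (shift_poly r l)"
  using min_poly_uniformizer(3)[OF uniformizer_step[OF assms]]
  by (intro min_poly_dvd assms) (simp add: eval_at_pcompose eval_at_shift_poly)

lemma admissible_min_polyI:
  assumes "uniformizer vL \<pi>" "\<And>i. i \<in> {1..n} \<Longrightarrow> val_ge (I (tval i) + int i) (coeff (mp \<pi>) (n - i))"
  shows "admissible (mp \<pi>)"
  using assms min_poly_uniformizer[OF assms(1)] by (simp add: admissible_def)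

lemma admissible_min_poly_perturb:
  assumes \<pi>: "uniformizer vL \<pi>" "admissible (mp \<pi>)" and \<pi>': "uniformizer vL \<pi>'"
    and l: "1 \<le> l" and above: "above l (int n) (mp \<pi>' - mp \<pi>)"
  shows "admissible (mp \<pi>')"
proof (rule admissible_min_polyI[OF \<pi>'])
  fix i assume i: "i \<in> {1..n}"
  have "\<forall>i\<in>{1..n}. val_ge (I (tval i) + int i) (coeff (mp \<pi>) (n - i))"
    using \<pi>(2) by (simp add: admissible_def)
  hence 1: "val_ge (I (tval i) + int i) (coeff (mp \<pi>) (n - i))" using i by blast
  have "val_ge (int n + phi l (tval (n - i)) - int (n - i)) (coeff (mp \<pi>' - mp \<pi>) (n - i))"
    using above unfolding above_def by blast
  moreover have "I (tval i) < phi l (tval (n - i))"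
    using phi_gt_I[OF tval_le l, of i] tval_compl[of i] i by simp
  ultimately have "val_ge (I (tval i) + int i) (coeff (mp \<pi>' - mp \<pi>) (n - i))"
    using i by (auto elim!: val_ge_mono simp: of_nat_diff)
  from val_ge_add[OF this 1] show "val_ge (I (tval i) + int i) (coeff (mp \<pi>') (n - i))" by simp
qed

lemma above_mono_level:
  assumes "above l T q" "l0 \<le> l" shows "above l0 T q"
  unfolding above_def
proof
  fix t
  have "val_ge (T + phi l (tval t) - int t) (coeff q t)" using assms(1) by (simp add: above_def)
  thus "val_ge (T + phi l0 (tval t) - int t) (coeff q t)"
    using phi_mono[OF assms(2), of "tval t"] by (auto elim: val_ge_mono)
qed

lemma above_min_poly_step:
  assumes "uniformizer vL \<pi>" "admissible (mp \<pi>)" "1 \<le> l" "val_ge 0 r"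
  shows "above l (int n) (mp (\<pi> + \<iota> r * \<pi> ^ (l + 1)) - mp \<pi>)"
  using assms min_poly_uniformizer[OF uniformizer_step[OF assms(1,3,4)]]
  by (intro above_perturbation(1)[where r = r] min_poly_step_dvd) simp_all

text \<open>
  An element that is congruent to \<open>\<pi>\<close> modulo \<open>\<M>\<^sub>L\<^sup>l\<^sup>+\<^sup>1\<close> is congruent to \<open>\<pi> + r \<pi>\<^sup>l\<^sup>+\<^sup>1\<close> modulo
  \<open>\<M>\<^sub>L\<^sup>l\<^sup>+\<^sup>2\<close>, for some integral \<open>r\<close> of the base field.
\<close>

lemma step_exists:
  assumes \<pi>: "uniformizer vL \<pi>" and "L.val_ge (int l + 1) (\<pi>' - \<pi>)"
  obtains r where "val_ge 0 r" "L.val_ge (int l + 2) (\<pi>' - (\<pi> + \<iota> r * \<pi> ^ (l + 1)))"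
proof -
  define y where "y = (\<pi>' - \<pi>) / \<pi> ^ (l + 1)"
  have y: "\<pi>' - \<pi> = y * \<pi> ^ (l + 1)" using uniformizer_L(3)[OF \<pi>] by (simp add: y_def)
  have "L.val_ge 0 y"
  proof (cases "y = 0")
    case False
    then obtain z :: int where z: "vL y = ereal (of_int z)" using L.v_nonzero by blast
    hence "vL (\<pi>' - \<pi>) = ereal (of_int (z + int (l + 1)))"
      unfolding y L.v_mult uniformizer_L(4)[OF \<pi>] by simp
    hence "int l + 1 \<le> z + int (l + 1)"
      using assms(2) unfolding L_val_ge_iff by (simp only: ereal_less_eq(3) of_int_le_iff)
    thus ?thesis using z by (simp add: L_val_ge_iff)
  qed simp
  then obtain r where r: "val_ge 0 r" "L.val_ge 1 (y - \<iota> r)" using residue_representative[OF \<pi>] by blast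
  have "L.val_ge (1 + int (l + 1)) ((y - \<iota> r) * \<pi> ^ (l + 1))"
    by (intro L.val_ge_mult r L_val_ge_uniformizer_power \<pi>)
  moreover have "(y - \<iota> r) * \<pi> ^ (l + 1) = \<pi>' - (\<pi> + \<iota> r * \<pi> ^ (l + 1))"
    using y by (simp add: algebra_simps)
  ultimately have "L.val_ge (int l + 2) (\<pi>' - (\<pi> + \<iota> r * \<pi> ^ (l + 1)))"
    by (simp add: add.commute)
  with r(1) that show thesis by blast
qed

text \<open>
  Substitutions \<open>\<pi> \<mapsto> \<pi> + r \<pi>\<^sup>i\<^sup>+\<^sup>1\<close> with \<open>i \<ge> l\<close> lead from \<open>\<pi>\<close> to a uniformizer as close to \<open>\<pi>'\<close> as desired,
  and each changes the minimal polynomial by terms above the threshold. For uniformizers that agree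
  modulo a high power of \<open>\<M>\<^sub>L\<close>, the value at \<open>\<pi>'\<close> of the minimal polynomial of \<open>\<pi>\<close> has so high a
  valuation that the coefficients of both minimal polynomials are close as well. So the number of steps
  is finite; it is the induction variable \<open>e\<close> below.
\<close>

proposition above_min_poly_diff:
  assumes "1 \<le> l" "uniformizer vL \<pi>'" "uniformizer vL \<pi>" "admissible (mp \<pi>)"
    and "L.val_ge (int l + 1) (\<pi>' - \<pi>)"
  shows "above l (int n) (mp \<pi>' - mp \<pi>)"
proof -
  \<comment> \<open>From level \<open>N\<close> on, all thresholds \<open>n + phi l q\<close> have been passed, as \<open>phi l q \<le> I 0 + l\<close>.\<close>
  define N where "N = l + nat (I 0) + n"
  have "above l (int n) (mp \<pi>' - mp \<pi>)"
    if "l \<le> l'" "N \<le> l' + e" "uniformizer vL \<pi>" "admissible (mp \<pi>)" "L.val_ge (int l' + 1) (\<pi>' - \<pi>)"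
    for l' e \<pi>
    using that
  proof (induction e arbitrary: l' \<pi>)
    case 0
    note f = min_poly_uniformizer[OF 0(3)] and f' = min_poly_uniformizer[OF assms(2)]
    have "L.val_ge (int l' + 1) (eval_at \<pi>' (mp \<pi>) - eval_at \<pi> (mp \<pi>))"
      by (intro val_ge_eval_at_diff min_poly_eisenstein(2) uniformizer_L(2) 0 assms(2))
    hence "L.val_ge (int l' + 1) (eval_at \<pi>' (mp \<pi>' - mp \<pi>))"
      using f f' by (simp add: eval_at_diff)
    moreover have "degree (mp \<pi>' - mp \<pi>) < n"
      using eq_zero_or_degree_less[of "mp \<pi>' - mp \<pi>" n] degree_diff_le[of "mp \<pi>'" n "mp \<pi>"]
        f f' n_pos by fastforce
    ultimately have c: "val_ge (int l' + 1 - int t) (coeff (mp \<pi>' - mp \<pi>) t)" for t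
      using coeff_bound_of_eval_at[OF assms(2)] by blast
    show ?case unfolding above_def
    proof
      fix t
      have "phi l (tval t) \<le> I 0 + int (p ^ 0 * l)" by (rule phi_le) simp
      also have "\<dots> + int n \<le> int l'" using 0(2) I_nonneg[of 0] by (simp add: N_def)
      finally have "int n + phi l (tval t) - int t \<le> int l' + 1 - int t" by simp
      with c show "val_ge (int n + phi l (tval t) - int t) (coeff (mp \<pi>' - mp \<pi>) t)" by (rule val_ge_mono)
    qed
  next
    case (Suc e)
    have l': "1 \<le> l'" using Suc.prems(1) assms(1) by simp
    obtain r where r: "val_ge 0 r" "L.val_ge (int l' + 2) (\<pi>' - (\<pi> + \<iota> r * \<pi> ^ (l' + 1)))"
      using step_exists[OF Suc.prems(3,5)] .
    let ?\<pi> = "\<pi> + \<iota> r * \<pi> ^ (l' + 1)"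
    have u: "uniformizer vL ?\<pi>" by (rule uniformizer_step[OF Suc.prems(3) l' r(1)])
    have L1: "above l' (int n) (mp ?\<pi> - mp \<pi>)"
      by (rule above_min_poly_step[OF Suc.prems(3,4) l' r(1)])
    have "admissible (mp ?\<pi>)"
      by (rule admissible_min_poly_perturb[OF Suc.prems(3,4) u l' L1])
    hence "above l (int n) (mp \<pi>' - mp ?\<pi>)"
      using Suc.prems u r by (intro Suc.IH[of "l' + 1"]) (simp_all add: add.commute)
    from above_add[OF this above_mono_level[OF L1 Suc.prems(1)]] show ?case by simp
  qed
  thus ?thesis using assms by (meson le_add2 order_refl)
qed

lemma admissible_scaled:
  assumes \<pi>: "uniformizer vL \<pi>" "admissible (mp \<pi>)" and u: "uniformizer vL (\<iota> r * \<pi>)" and r: "val_ge 0 r"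
  shows "admissible (mp (\<iota> r * \<pi>))"
proof -
  note f = min_poly_uniformizer[OF \<pi>(1)]
  define g where "g = (\<Sum>t\<le>n. monom (r ^ (n - t) * coeff (mp \<pi>) t) t)"
  have cg: "coeff g t = (if t \<le> n then r ^ (n - t) * coeff (mp \<pi>) t else 0)" for t
    by (simp add: g_def coeff_sum)
  have "degree g \<le> n" by (intro degree_le) (simp add: cg)
  moreover have "coeff g n = 1" using f cg by simp
  ultimately have "degree g = n" using le_degree[of g n] by simp
  moreover have "eval_at (\<iota> r * \<pi>) g = \<iota> r ^ n * eval_at \<pi> (mp \<pi>)"
  proof -
    have "eval_at (\<iota> r * \<pi>) g = (\<Sum>t\<le>n. \<iota> (r ^ (n - t) * coeff (mp \<pi>) t) * (\<iota> r * \<pi>) ^ t)"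
      by (simp add: g_def eval_at_sum eval_at_monom)
    also have "\<dots> = (\<Sum>t\<le>n. \<iota> r ^ n * (\<iota> (coeff (mp \<pi>) t) * \<pi> ^ t))"
    proof (intro sum.cong refl)
      fix t assume "t \<in> {..n}"
      hence "\<iota> r ^ n = \<iota> r ^ (n - t) * \<iota> r ^ t" by (simp flip: power_add)
      thus "\<iota> (r ^ (n - t) * coeff (mp \<pi>) t) * (\<iota> r * \<pi>) ^ t =
          \<iota> r ^ n * (\<iota> (coeff (mp \<pi>) t) * \<pi> ^ t)"
        by (simp add: iota_mult iota_power power_mult_distrib)
    qed
    also have "\<dots> = \<iota> r ^ n * eval_at \<pi> (mp \<pi>)"
      using eval_at_altdef[of "mp \<pi>" n \<pi>] f(1) by (simp only: sum_distrib_left order_refl)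
    finally show ?thesis .
  qed
  ultimately have g: "mp (\<iota> r * \<pi>) = g" using f \<open>coeff g n = 1\<close> by (intro min_poly_eqI u) auto
  have "\<forall>i\<in>{1..n}. val_ge (I (tval i) + int i) (coeff (mp \<pi>) (n - i))"
    using \<pi>(2) by (simp add: admissible_def)
  hence *: "val_ge (I (tval i) + int i) (coeff (mp \<pi>) (n - i) * r ^ i)" if "i \<in> {1..n}" for i
    using that by (intro val_ge_mult_int[OF _ val_ge_power_0[OF r]]) blast
  show ?thesis
  proof (rule admissible_min_polyI[OF u])
    fix i assume "i \<in> {1..n}"
    thus "val_ge (I (tval i) + int i) (coeff (mp (\<iota> r * \<pi>)) (n - i))"
      using *[of i] unfolding g by (simp add: cg mult.commute)
  qed
qed

text \<open>
  Any uniformizer is congruent modulo \<open>\<M>\<^sub>L\<^sup>2\<close> to a multiple of a given one by a unit of the base field.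
  So bounds by \<open>I\<close> for the minimal polynomial of one uniformizer hold for all: this is the half of the
  independence of the indices of inseparability of the uniformizer that is needed here.
\<close>

proposition admissible_any_uniformizer:
  assumes \<pi>: "uniformizer vL \<pi>" "admissible (mp \<pi>)" and \<pi>': "uniformizer vL \<pi>'"
  shows "admissible (mp \<pi>')"
proof -
  define y where "y = \<pi>' / \<pi>"
  have y: "\<pi>' = y * \<pi>" using uniformizer_L(3)[OF \<pi>(1)] by (simp add: y_def)
  have "y \<noteq> 0" using y uniformizer_L(3)[OF \<pi>'] by auto
  then obtain z :: int where z: "vL y = ereal (of_int z)" using L.v_nonzero by blast
  have "vL \<pi>' = vL y + vL \<pi>" unfolding y by (rule L.v_mult)
  hence "L.val_ge 0 y" using \<pi>(1) \<pi>' z by (simp add: uniformizer_def L_val_ge_iff one_ereal_def)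
  then obtain r where r: "val_ge 0 r" "L.val_ge 1 (y - \<iota> r)" using residue_representative[OF \<pi>(1)] by blast
  have "L.val_ge (1 + 1) ((y - \<iota> r) * \<pi>)" by (intro L.val_ge_mult r uniformizer_L \<pi>)
  moreover have "(y - \<iota> r) * \<pi> = \<pi>' - \<iota> r * \<pi>" by (simp add: y algebra_simps)
  ultimately have d: "L.val_ge 2 (\<pi>' - \<iota> r * \<pi>)" by simp
  hence "L.val_ge 2 (\<iota> r * \<pi> - \<pi>')" using L.val_ge_uminus[of 2 "\<pi>' - \<iota> r * \<pi>"] by simp
  from L_val_ge_cong_uniformizer[OF \<pi>' this] have u: "uniformizer vL (\<iota> r * \<pi>)" .
  have a: "admissible (mp (\<iota> r * \<pi>))" by (rule admissible_scaled[OF \<pi> u r(1)])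
  have "above 1 (int n) (mp \<pi>' - mp (\<iota> r * \<pi>))" using d by (intro above_min_poly_diff \<pi>' u a) simp_all
  from admissible_min_poly_perturb[OF u a \<pi>' _ this] show ?thesis by simp
qed

text \<open>
  Between \<open>\<pi> + r \<pi>\<^sup>l\<^sup>+\<^sup>1\<close> and \<open>\<pi>'\<close> the coefficient changes only by terms above the threshold for
  \<open>l + 1\<close>, which is larger than that for \<open>l\<close>.
\<close>

proposition min_poly_coeff_perturbation:
  assumes \<pi>: "uniformizer vL \<pi>" "admissible (mp \<pi>)" and \<pi>': "uniformizer vL \<pi>'"
    and l: "1 \<le> l" and r: "val_ge 0 r"
    and cong: "L.val_ge (int l + 2) (\<pi>' - (\<pi> + \<iota> r * \<pi> ^ (l + 1)))"
    and Phi: "phi l j = int n * k - int h" and j: "trunc_val p \<nu> (phi l j) = j"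
    and h: "1 \<le> h" "h \<le> n"
    and A: "\<And>m. m \<le> j \<Longrightarrow> I m = A m * int n - int (b m)"
    and S: "S = {m. m \<le> j \<and> phi l j = I m + int (p ^ m * l)}"
  shows "val_ge (int n * (k + 1))
    (coeff (mp \<pi>' - mp \<pi>) (n - h) + (\<Sum>m\<in>S. leading_term (mp \<pi>) l r (b m mod n) (p ^ m)))"
proof -
  let ?\<pi> = "\<pi> + \<iota> r * \<pi> ^ (l + 1)"
  have u: "uniformizer vL ?\<pi>" by (rule uniformizer_step[OF \<pi>(1) l r])
  have L1: "above l (int n) (mp ?\<pi> - mp \<pi>)" by (rule above_min_poly_step[OF \<pi> l r])
  have a: "admissible (mp ?\<pi>)" by (rule admissible_min_poly_perturb[OF \<pi> u l L1])
  have "above (l + 1) (int n) (mp \<pi>' - mp ?\<pi>)"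
    using cong by (intro above_min_poly_diff \<pi>' u a) (simp_all add: add.commute)
  hence "val_ge (int n + phi (l + 1) (tval (n - h)) - int (n - h)) (coeff (mp \<pi>' - mp ?\<pi>) (n - h))"
    unfolding above_def by blast
  moreover have "int n * k + 1 \<le> int n + phi (l + 1) (tval (n - h)) - int (n - h)"
    using phi_strict_mono[of l "l + 1" j] tval_compl_residue(1)[OF Phi j h(2)] Phi h
    by (simp add: of_nat_diff)
  ultimately have "val_ge (int n * k + 1) (coeff (mp \<pi>' - mp ?\<pi>) (n - h))" by (rule val_ge_mono)
  from val_ge_round_up[OF this] have 1: "val_ge (int n * (k + 1)) (coeff (mp \<pi>' - mp ?\<pi>) (n - h))" .
  have 2: "val_ge (int n * (k + 1)) (coeff (mp ?\<pi> - mp \<pi>) (n - h) +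
      (\<Sum>m\<in>S. leading_term (mp \<pi>) l r (b m mod n) (p ^ m)))"
    using min_poly_uniformizer[OF u]
    by (intro perturbation_coeff[OF \<pi>(2) _ _ l r min_poly_step_dvd[OF \<pi>(1) l r] Phi j h A S]) simp_all
  have "coeff (mp \<pi>' - mp ?\<pi>) (n - h) + (coeff (mp ?\<pi> - mp \<pi>) (n - h) +
      (\<Sum>m\<in>S. leading_term (mp \<pi>) l r (b m mod n) (p ^ m))) = coeff (mp \<pi>' - mp \<pi>) (n - h) +
      (\<Sum>m\<in>S. leading_term (mp \<pi>) l r (b m mod n) (p ^ m))" by simp
  with val_ge_add[OF 1 2] show ?thesis by (simp only:)
qed

end

section \<open>Indices of inseparability as thresholds\<close>

context tot_ramified_ext
begin

lemma insep_index_pre_le: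
  assumes "1 \<le> h" "h \<le> n" "trunc_val p \<nu> (int h) \<le> j"
  shows "insep_index_pre vK \<iota> p \<nu> \<pi> j \<le>
    ereal (real n) * vK (min_poly_coeff \<iota> \<pi> h) - ereal (real h)"
  unfolding insep_index_pre_def deg using assms by (intro Min_le) auto

lemma insep_index_pre_attained:
  obtains h where "1 \<le> h" "h \<le> n" "trunc_val p \<nu> (int h) \<le> j"
    "insep_index_pre vK \<iota> p \<nu> \<pi> j =
      ereal (real n) * vK (min_poly_coeff \<iota> \<pi> h) - ereal (real h)"
proof -
  let ?A = "{ereal (real n) * vK (min_poly_coeff \<iota> \<pi> h) - ereal (real h) | h.
    1 \<le> h \<and> h \<le> n \<and> trunc_val p \<nu> (int h) \<le> j}"
  have "trunc_val p \<nu> (int 1) \<le> j" by (simp add: trunc_val_def)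
  hence "?A \<noteq> {}" using n_pos by fastforce
  moreover have "finite ?A" by simp
  ultimately have "Min ?A \<in> ?A" by (rule Min_in[rotated])
  thus ?thesis using that by (auto simp: insep_index_pre_def deg)
qed

lemma insep_index_pre_antimono:
  assumes "j \<le> j'" shows "insep_index_pre vK \<iota> p \<nu> \<pi> j' \<le> insep_index_pre vK \<iota> p \<nu> \<pi> j"
  using insep_index_pre_attained[of p \<nu> j \<pi>] insep_index_pre_le[of _ p \<nu> j' \<pi>] assms
  by (metis order_trans)

lemma insep_index_at_le:
  assumes "m \<le> j" "j \<le> \<nu>"
  shows "insep_index_at vK vL \<iota> p \<nu> \<pi> m \<le>
    insep_index_pre vK \<iota> p \<nu> \<pi> j + ereal (real (j - m)) * vL (of_nat p)"
  unfolding insep_index_at_def using assms by (intro Min_le) auto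

lemma insep_index_at_attained:
  assumes "m \<le> \<nu>"
  obtains j where "m \<le> j" "j \<le> \<nu>" "insep_index_at vK vL \<iota> p \<nu> \<pi> m =
    insep_index_pre vK \<iota> p \<nu> \<pi> j + ereal (real (j - m)) * vL (of_nat p)"
proof -
  let ?A = "(\<lambda>j. insep_index_pre vK \<iota> p \<nu> \<pi> j + ereal (real (j - m)) * vL (of_nat p)) ` {m..\<nu>}"
  have "Min ?A \<in> ?A" using assms by (intro Min_in) auto
  thus ?thesis using that by (auto simp: insep_index_at_def)
qed

text \<open>
  The indices of inseparability, if finite, have the properties required of \<open>I\<close>. The index \<open>I \<nu>\<close> is
  \<open>0\<close> because the constant term of an Eisenstein polynomial is a uniformizer.
\<close>

proposition insep_index_at_data:
  assumes p: "prime p" "p ^ \<nu> dvd n" "val_ge (int n) (of_nat p)" and \<pi>: "uniformizer vL \<pi>"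
    and I: "\<And>m. m \<le> \<nu> \<Longrightarrow> insep_index_at vK vL \<iota> p \<nu> \<pi> m = ereal (of_int (I m))"
  shows "insep_data vK n p \<nu> I"
    and "\<And>i. i \<in> {1..n} \<Longrightarrow>
      val_ge (I (trunc_val p \<nu> (int i)) + int i) (coeff (mp \<pi>) (n - i))"
proof -
  let ?P = "insep_index_pre vK \<iota> p \<nu> \<pi>" and ?e = "vL (of_nat p)"
  have e: "?e = ereal (real n) * vK (of_nat p)"
    using ram deg iota_of_nat[of p] by (metis totally_ramified_def)
  have e_nonneg: "0 \<le> ?e"
    using L.val_ge_of_nat[of p] by (simp add: L_val_ge_iff zero_ereal_def)
  have le: "ereal (of_int (I m)) \<le> ?P j + ereal (real (j - m)) * ?e" if "m \<le> j" "j \<le> \<nu>" for m j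
    using insep_index_at_le[OF that, of p \<pi>] I[of m] that by simp
  have le0: "ereal (of_int (I m)) \<le> ?P m" if "m \<le> \<nu>" for m
    using le[of m m] that by (simp flip: zero_ereal_def)
  have coeff: "vK (min_poly_coeff \<iota> \<pi> h) = vK (coeff (mp \<pi>) (n - h))" for h
    unfolding min_poly_coeff_eq[OF \<pi>] by (cases "even h") simp_all
  have trunc_le: "trunc_val p \<nu> (int h) \<le> \<nu>" for h by (simp add: trunc_val_def)
  have val_ge_of_bound: "val_ge (T + int h) x" if "ereal (of_int T) \<le> ereal (real n) * vK x - ereal (real h)"
    for T h x
  proof (cases "x = 0")
    case False
    then obtain z :: int where z: "vK x = ereal (of_int z)" using v_nonzero by blast
    have "real_of_int T \<le> real_of_int (int n * z - int h)" using that z by simp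
    hence "T \<le> int n * z - int h" by (simp only: of_int_le_iff)
    thus ?thesis using z by (auto simp: val_ge_iff)
  qed simp
  show "val_ge (I (trunc_val p \<nu> (int i)) + int i) (coeff (mp \<pi>) (n - i))" if i: "i \<in> {1..n}" for i
  proof (rule val_ge_of_bound)
    have "ereal (of_int (I (trunc_val p \<nu> (int i)))) \<le> ?P (trunc_val p \<nu> (int i))"
      by (rule le0[OF trunc_le])
    also have "\<dots> \<le> ereal (real n) * vK (min_poly_coeff \<iota> \<pi> i) - ereal (real i)"
      using i by (intro insep_index_pre_le) auto
    finally show "ereal (of_int (I (trunc_val p \<nu> (int i)))) \<le>
        ereal (real n) * vK (coeff (mp \<pi>) (n - i)) - ereal (real i)" unfolding coeff .
  qed
  show "insep_data vK n p \<nu> I"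
  proof
    show "prime p" "p ^ \<nu> dvd n" "val_ge (int n) (of_nat p)" by fact+
    show "I m' \<le> I m" if m: "m \<le> m'" "m' \<le> \<nu>" for m m'
    proof -
      obtain j where j: "m \<le> j" "j \<le> \<nu>"
        "insep_index_at vK vL \<iota> p \<nu> \<pi> m = ?P j + ereal (real (j - m)) * ?e"
        using insep_index_at_attained[of m \<nu> p \<pi>] m by auto
      have "ereal (of_int (I m')) \<le> ?P j + ereal (real (j - m)) * ?e"
      proof (cases "m' \<le> j")
        case True
        have "ereal (of_int (I m')) \<le> ?P j + ereal (real (j - m')) * ?e" using le True j(2) .
        also have "\<dots> \<le> ?P j + ereal (real (j - m)) * ?e"
          using m by (intro add_left_mono ereal_mult_right_mono e_nonneg) simp
        finally show ?thesis .
      next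
        case False
        have "ereal (of_int (I m')) \<le> ?P m'" using m by (intro le0)
        also have "\<dots> \<le> ?P j" using False by (intro insep_index_pre_antimono) simp
        also have "\<dots> + 0 \<le> ?P j + ereal (real (j - m)) * ?e"
          using e_nonneg by (intro add_left_mono) simp
        finally show ?thesis by simp
      qed
      also have "\<dots> = ereal (of_int (I m))" using j(3) I[of m] m by simp
      finally show ?thesis by (simp only: ereal_less_eq(3) of_int_le_iff)
    qed
    show "I \<nu> = 0"
    proof -
      have P: "ereal (of_int (I \<nu>)) = ?P \<nu>"
      proof -
        obtain j where "\<nu> \<le> j" "j \<le> \<nu>"
          "insep_index_at vK vL \<iota> p \<nu> \<pi> \<nu> = ?P j + ereal (real (j - \<nu>)) * ?e"
          using insep_index_at_attained[of \<nu> \<nu> p \<pi>] by auto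
        thus ?thesis using I[of \<nu>] by (simp flip: zero_ereal_def)
      qed
      obtain h where h: "1 \<le> h" "h \<le> n"
        "?P \<nu> = ereal (real n) * vK (coeff (mp \<pi>) (n - h)) - ereal (real h)"
        using insep_index_pre_attained[of p \<nu> \<nu> \<pi>] unfolding coeff by metis
      have ogh: "val_ge (int h) (coeff (mp \<pi>) (n - h))"
        using min_poly_eisenstein(1)[OF \<pi>, of "n - h"] h n_pos by (simp add: of_nat_diff)
      have "coeff (mp \<pi>) (n - h) \<noteq> 0" using P h(3) n_pos by auto
      then obtain z :: int where z: "vK (coeff (mp \<pi>) (n - h)) = ereal (of_int z)"
        using v_nonzero by blast
      have "real_of_int (I \<nu>) = real_of_int (int n * z - int h)" using P h(3) z by simp
      hence Iz: "I \<nu> = int n * z - int h" by (simp only: of_int_eq_iff)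
      have "int h \<le> int n * z" using ogh z \<open>coeff (mp \<pi>) (n - h) \<noteq> 0\<close> by (auto simp: val_ge_iff)
      hence nonneg: "0 \<le> I \<nu>" using Iz by simp
      have "val_ge (I \<nu> + int n) (coeff (mp \<pi>) (n - n))"
      proof (rule val_ge_of_bound)
        have "ereal (of_int (I \<nu>)) \<le> ?P \<nu>" by (simp add: P)
        also have "\<dots> \<le> ereal (real n) * vK (min_poly_coeff \<iota> \<pi> n) - ereal (real n)"
          using n_pos trunc_le by (intro insep_index_pre_le) auto
        finally show "ereal (of_int (I \<nu>)) \<le>
            ereal (real n) * vK (coeff (mp \<pi>) (n - n)) - ereal (real n)" unfolding coeff .
      qed
      moreover have "\<not> val_ge (int n + 1) (coeff (mp \<pi>) (n - n))"
        using min_poly_eisenstein(3)[OF \<pi>] by simp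
      ultimately have "\<not> int n + 1 \<le> I \<nu> + int n" using val_ge_mono by blast
      thus ?thesis using nonneg by simp
    qed
    show "val_ge (I m - I m') (of_nat (p ^ (m' - m)))" if m: "m \<le> m'" "m' \<le> \<nu>" for m m'
    proof -
      obtain j where j: "m' \<le> j" "j \<le> \<nu>"
        "insep_index_at vK vL \<iota> p \<nu> \<pi> m' = ?P j + ereal (real (j - m')) * ?e"
        using insep_index_at_attained[of m' \<nu> p \<pi>] m by auto
      have "real (j - m) = real (j - m') + real (m' - m)" using m j by simp
      hence "ereal (real (j - m)) * ?e = ereal (real (j - m')) * ?e + ereal (real (m' - m)) * ?e"
        by (simp add: ereal_left_distrib flip: plus_ereal.simps(1))
      hence "ereal (of_int (I m)) \<le> ereal (of_int (I m')) + ereal (real (m' - m)) * ?e"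
        using le[of m j] m j I[of m'] by (simp add: add.assoc)
      moreover have "ereal (real n) * vK (of_nat (p ^ (m' - m))) = ereal (real (m' - m)) * ?e"
      proof -
        have "vL (of_nat p ^ i) = ereal (real i) * ?e" for i
        proof (induction i)
          case (Suc i)
          have "ereal (real (Suc i)) * ?e = ?e + ereal (real i) * ?e"
            by (simp add: ereal_left_distrib one_ereal_def flip: plus_ereal.simps(1))
          thus ?case using Suc by (simp add: L.v_mult)
        qed (simp flip: zero_ereal_def)
        moreover have "ereal (real n) * vK (of_nat (p ^ (m' - m))) = vL (\<iota> (of_nat (p ^ (m' - m))))"
          using ram deg by (simp add: totally_ramified_def)
        ultimately show ?thesis by (simp add: iota_of_nat iota_power)
      qed
      ultimately show ?thesis unfolding val_ge_def
        by (cases "ereal (real (m' - m)) * ?e") auto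
    qed
  qed
qed

end

section \<open>The congruence for the coefficients\<close>

theorem theorem4p5:
  fixes vK :: "'k::field \<Rightarrow> ereal" and vL :: "'l::field \<Rightarrow> ereal" and \<iota> :: "'k \<Rightarrow> 'l"
    and p n u \<nu> \<l> j h :: nat
    and A :: "nat \<Rightarrow> int" and b :: "nat \<Rightarrow> nat"
    and \<pi> \<pi>' :: 'l and r :: 'k and \<sigma> :: "'l \<Rightarrow> 'l"
    and c c' g :: "nat \<Rightarrow> 'k" and \<Phi> k h\<^sub>0 :: int and S :: "nat set"
  assumes "normalized_discrete_valuation vK" and "valuation_complete vK"
    and "perfect_residue_field vK p"
    and "field_embedding \<iota>" and "separable_extension \<iota>"
    and "field_degree \<iota> = n" and "n = u * p ^ \<nu>" and "\<not> p dvd u"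
    and "normalized_discrete_valuation vL" and "totally_ramified vK vL \<iota>"
    and "\<And>m. m \<le> \<nu> \<Longrightarrow>
           insep_index vK vL \<iota> p \<nu> m = ereal (of_int (A m * int n - int (b m))) \<and>
           1 \<le> b m \<and> b m \<le> n"
    and "uniformizer vL \<pi>" and "uniformizer vL \<pi>'"
    and "c = min_poly_coeff \<iota> \<pi>" and "c' = min_poly_coeff \<iota> \<pi>'"
    and "1 \<le> \<l>" and "r \<in> valuation_ring vK" and "\<sigma> \<in> field_Aut \<iota>"
    and "cong_mod (\<sigma> \<pi>') (\<pi> + \<iota> r * \<pi> ^ (\<l> + 1)) (max_ideal_pow vL (int \<l> + 2))"
    and "j \<le> \<nu>"
    and "HH vK vL \<iota> p \<nu> j (real \<l>) = ereal (of_int \<Phi>)" and "trunc_val p \<nu> \<Phi> = j"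
    and "1 \<le> h" and "h \<le> n" and "int n dvd \<Phi> + int h"
    and "k = (\<Phi> + int h) div int n" and "h\<^sub>0 = int h div int p ^ j"
    and "S = {m. m \<le> j \<and> HH vK vL \<iota> p \<nu> j (real \<l>) = HH_tilde vK vL \<iota> p \<nu> m (real \<l>)}"
    and "\<And>m. m \<in> S \<Longrightarrow> g m =
           (if b m < h then
              (-1) powi (k + int \<l> + A m) *
                of_int (h\<^sub>0 * int p ^ (j - m) + int \<l> - int u * int p ^ (\<nu> - m))
            else if b m < n then
              (-1) powi (k + int \<l> + A m) * of_int (h\<^sub>0 * int p ^ (j - m) + int \<l>)
            else
              (-1) powi (k + int \<l> + A m) * of_int (int u * int p ^ (\<nu> - m)))"
  shows "cong_mod (c' h)
           (c h + (\<Sum>m\<in>S. g m * c n powi (k - A m) * c (b m) * r ^ (p ^ m)))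
           (max_ideal_pow vK (k + 1))"
proof -
  have "u \<noteq> 0" using assms(8) by (metis dvd_0_right)
  moreover have "prime p" and pK: "of_nat p \<in> max_ideal_pow vK 1"
    using assms(3) by (auto simp: perfect_residue_field_def)
  moreover have p0: "0 < p" using \<open>prime p\<close> by (rule prime_gt_0_nat)
  ultimately have n_pos: "0 < n" using assms(7) by simp
  interpret tot_ramified_ext vK n vL \<iota>
    by unfold_locales (use assms n_pos in auto)
  have val_ge_p: "val_ge (int n) (of_nat p)"
  proof (cases "of_nat p = (0 :: 'k)")
    case False
    then obtain z :: int where z: "vK (of_nat p) = ereal (of_int z)" using v_nonzero by blast
    hence "1 \<le> z" using pK by (simp add: max_ideal_pow_def)
    hence "int n * 1 \<le> int n * z" by (intro mult_left_mono) simp_all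
    thus ?thesis using z by (auto simp: val_ge_iff)
  qed simp
  \<comment> \<open>The uniformizer from which \<open>insep_index\<close> is computed.\<close>
  define \<pi>\<^sub>0 where "\<pi>\<^sub>0 = (SOME \<pi>. uniformizer vL \<pi>)"
  have \<pi>\<^sub>0: "uniformizer vL \<pi>\<^sub>0" unfolding \<pi>\<^sub>0_def using assms(12) by (rule someI)
  define I where "I m = A m * int n - int (b m)" for m
  have I: "insep_index vK vL \<iota> p \<nu> m = ereal (of_int (I m))" if "m \<le> \<nu>" for m
    using assms(11)[OF that] by (simp add: I_def)
  hence I0: "insep_index_at vK vL \<iota> p \<nu> \<pi>\<^sub>0 m = ereal (of_int (I m))" if "m \<le> \<nu>" for m
    using that by (simp add: insep_index_def \<pi>\<^sub>0_def)
  have pn: "p ^ \<nu> dvd n" using assms(7) by simp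
  note data = insep_index_at_data[OF \<open>prime p\<close> pn val_ge_p \<pi>\<^sub>0 I0]
  interpret insep_data vK n p \<nu> I by (rule data(1))
  interpret insep_ext vK n vL \<iota> p \<nu> I ..
  have "admissible (mp \<pi>\<^sub>0)"
    by (rule admissible_min_polyI[OF \<pi>\<^sub>0]) (unfold tval_def, rule data(2))
  with \<pi>\<^sub>0 have adm: "admissible (mp \<pi>)" using assms(12) by (rule admissible_any_uniformizer)
  have r: "val_ge 0 r"
    using assms(17) by (simp add: val_ge_def valuation_ring_def flip: zero_ereal_def)
  have HH_tilde: "HH_tilde vK vL \<iota> p \<nu> m (real \<l>) = ereal (of_int (I m + int (p ^ m * \<l>)))"
    if "m \<le> \<nu>" for m using I[OF that] by (simp add: HH_tilde_def)
  have "HH vK vL \<iota> p \<nu> j (real \<l>) = ereal (of_int (phi \<l> j))"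
    unfolding HH_def
  proof (rule Min_eqI)
    fix y assume "y \<in> (\<lambda>m. HH_tilde vK vL \<iota> p \<nu> m (real \<l>)) ` {0..j}"
    then obtain m where m: "m \<le> j" "y = HH_tilde vK vL \<iota> p \<nu> m (real \<l>)" by auto
    hence "y = ereal (of_int (I m + int (p ^ m * \<l>)))" using HH_tilde[of m] assms(20) by simp
    thus "ereal (of_int (phi \<l> j)) \<le> y"
      using phi_le[OF m(1), of \<l>] by (simp only: ereal_less_eq(3) of_int_le_iff)
  next
    obtain m where "m \<le> j" "phi \<l> j = I m + int (p ^ m * \<l>)" by (rule phi_attained)
    thus "ereal (of_int (phi \<l> j)) \<in> (\<lambda>m. HH_tilde vK vL \<iota> p \<nu> m (real \<l>)) ` {0..j}"
      using HH_tilde[of m] assms(20) by (intro image_eqI[of _ _ m]) simp_all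
  qed simp
  hence \<Phi>: "phi \<l> j = \<Phi>" using assms(21) by simp
  have S: "S = {m. m \<le> j \<and> phi \<l> j = I m + int (p ^ m * \<l>)}"
  proof -
    have "HH vK vL \<iota> p \<nu> j (real \<l>) = HH_tilde vK vL \<iota> p \<nu> m (real \<l>) \<longleftrightarrow>
        phi \<l> j = I m + int (p ^ m * \<l>)" if "m \<le> j" for m
      using HH_tilde[of m] that assms(20) unfolding assms(21) \<Phi>
      by (simp only: ereal.inject of_int_eq_iff order_trans)
    thus ?thesis unfolding assms(28) by blast
  qed
  have Phi: "phi \<l> j = int n * k - int h" using assms(25,26) \<Phi> by simp
  have j: "trunc_val p \<nu> (phi \<l> j) = j" using assms(22) \<Phi> by simp
  note pm_h = tval_compl_residue(2)[OF Phi j assms(24)]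
  have cong: "L.val_ge (int \<l> + 2) (\<sigma> \<pi>' - (\<pi> + \<iota> r * \<pi> ^ (\<l> + 1)))"
    using assms(19) by (simp add: cong_mod_def max_ideal_pow_def L_val_ge_iff)
  have "uniformizer vL (\<pi> + \<iota> r * \<pi> ^ (\<l> + 1))"
    using assms(12,16) r by (rule uniformizer_step)
  hence u: "uniformizer vL (\<sigma> \<pi>')"
    by (rule L_val_ge_cong_uniformizer) (rule L.val_ge_mono[OF cong], simp)
  have mp: "mp (\<sigma> \<pi>') = mp \<pi>'" by (rule min_poly_Aut[OF assms(18,13) u])
  have main: "val_ge (int n * (k + 1)) (coeff (mp \<pi>' - mp \<pi>) (n - h) +
      (\<Sum>m\<in>S. leading_term (mp \<pi>) \<l> r (b m mod n) (p ^ m)))"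
    using min_poly_coeff_perturbation[OF assms(12) adm u assms(16) r cong Phi j assms(23,24) I_def S]
    unfolding mp .
  have c: "c = (\<lambda>i. (-1) ^ i * coeff (mp \<pi>) (n - i))"
    unfolding assms(14) by (rule ext) (rule min_poly_coeff_eq[OF assms(12)])
  have c': "c' h = (-1) ^ h * coeff (mp \<pi>') (n - h)"
    unfolding assms(15) by (rule min_poly_coeff_eq[OF assms(13)])
  have terms: "val_ge (int n * (k + 1)) ((-1) ^ h * leading_term (mp \<pi>) \<l> r (b m mod n) (p ^ m) +
      g m * c n powi (k - A m) * c (b m) * r ^ (p ^ m))" if mS: "m \<in> S" for m
  proof -
    have m: "m \<le> j" "phi \<l> j = I m + int (p ^ m * \<l>)" using mS S by auto
    have mn: "m \<le> \<nu>" using m assms(20) by simp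
    have bm: "1 \<le> b m" "b m \<le> n" using assms(11)[OF mn] by auto
    have q: "int (p ^ m) \<noteq> 0" using p0 by simp
    \<comment> \<open>The equation \<open>\<Phi> = n k - h = n A\<^sub>m - b\<^sub>m + p\<^sup>m \<l>\<close>; as \<open>p\<^sup>m\<close> divides \<open>n\<close> and \<open>h\<close>, it divides \<open>b\<^sub>m\<close>.\<close>
    have key: "(k - A m) * int n = int (p ^ m * \<l>) + int h - int (b m)"
      using m(2) Phi by (simp add: I_def algebra_simps)
    define w where "w = u * p ^ (\<nu> - m)"
    have w: "n = p ^ m * w" using assms(7) mn by (simp add: w_def flip: power_add)
    obtain \<eta> where \<eta>: "h = p ^ m * \<eta>" using pm_h[OF m(1)] by blast
    have "int (b m) = int (p ^ m) * (int \<l> + int \<eta> - (k - A m) * int w)"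
      using key w \<eta> by (simp add: algebra_simps)
    hence "p ^ m dvd b m" by (metis dvd_triv_left int_dvd_int_iff)
    then obtain \<beta> where \<beta>: "b m = p ^ m * \<beta>" by blast
    have "0 \<le> k - A m"
    proof (rule ccontr)
      assume "\<not> 0 \<le> k - A m"
      hence "(k - A m) * int n \<le> (-1) * int n" by (intro mult_right_mono) simp_all
      moreover have "0 \<le> int (p ^ m * \<l>)" by simp
      ultimately show False using key bm(2) assms(23) by linarith
    qed
    then obtain e where e: "k - A m = int e" by (rule nonneg_int_cases)
    have "int (p ^ m) * (int e * int w) = int (p ^ m) * (int \<l> + int \<eta> - int \<beta>)"
      using key w \<eta> \<beta> e by (simp add: algebra_simps)
    hence ew: "int e * int w = int \<l> + int \<eta> - int \<beta>" by (simp only: mult_left_cancel[OF q])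
    define G where "G = (if b m < h then int \<eta> + int \<l> - int w
      else if b m < n then int \<eta> + int \<l> else int w)"
    have h0: "h\<^sub>0 * int p ^ (j - m) = int \<eta>"
    proof -
      have "int h = h\<^sub>0 * int p ^ j"
        using pm_h[OF order_refl] unfolding assms(27) by (metis dvd_div_mult_self int_dvd_int_iff of_nat_power)
      also have "int p ^ j = int p ^ (j - m) * int p ^ m" using m(1) by (simp flip: power_add)
      finally have "int (p ^ m) * (h\<^sub>0 * int p ^ (j - m)) = int (p ^ m) * int \<eta>"
        unfolding \<eta> of_nat_mult of_nat_power by (simp only: ac_simps)
      thus ?thesis by (simp only: mult_left_cancel[OF q])
    qed
    have sgn: "(-1) powi (k + int \<l> + A m) = ((-1) ^ (e + \<l>) :: 'k)"
    proof -
      have "k + int \<l> + A m = 2 * A m + int (e + \<l>)" using e by simp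
      hence "(-1) powi (k + int \<l> + A m) = ((-1) powi (2 * A m) * (-1) powi int (e + \<l>) :: 'k)"
        by (simp add: power_int_add)
      also have "(-1) powi (2 * A m) = (1 :: 'k)" by (simp add: power_int_mult)
      finally show ?thesis by (simp only: mult_1_left power_int_of_nat)
    qed
    have g: "g m = (-1) ^ (e + \<l>) * of_int G"
      using assms(29)[OF mS] unfolding sgn G_def h0 w_def by simp
    have "val_ge (int n * (A m + int e + 1))
      ((-1) ^ h * leading_term (mp \<pi>) \<l> r (b m mod n) (p ^ m) +
       (-1) ^ (e + \<l>) * of_int G * c n ^ e * c (b m) * r ^ (p ^ m))"
      by (rule leading_term_value[OF adm mn bm assms(23,24) I_def \<beta> w \<eta> ew r G_def c])
    moreover have "A m + int e = k" using e by simp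
    moreover have "c n powi (k - A m) = c n ^ e" by (simp add: e)
    ultimately show ?thesis using g by simp
  qed
  have "val_ge (int n * (k + 1)) ((coeff (mp \<pi>' - mp \<pi>) (n - h) +
      (\<Sum>m\<in>S. leading_term (mp \<pi>) \<l> r (b m mod n) (p ^ m))) * (-1) ^ h -
      (\<Sum>m\<in>S. (-1) ^ h * leading_term (mp \<pi>) \<l> r (b m mod n) (p ^ m) +
        g m * c n powi (k - A m) * c (b m) * r ^ (p ^ m)))"
  proof (rule val_ge_diff)
    have "val_ge 0 ((-1) ^ h)" by (rule val_ge_power_0) simp
    with main show "val_ge (int n * (k + 1)) ((coeff (mp \<pi>' - mp \<pi>) (n - h) +
      (\<Sum>m\<in>S. leading_term (mp \<pi>) \<l> r (b m mod n) (p ^ m))) * (-1) ^ h)" by (rule val_ge_mult_int)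
  qed (intro val_ge_sum terms)
  also have "(coeff (mp \<pi>' - mp \<pi>) (n - h) +
      (\<Sum>m\<in>S. leading_term (mp \<pi>) \<l> r (b m mod n) (p ^ m))) * (-1) ^ h -
      (\<Sum>m\<in>S. (-1) ^ h * leading_term (mp \<pi>) \<l> r (b m mod n) (p ^ m) +
        g m * c n powi (k - A m) * c (b m) * r ^ (p ^ m)) =
      c' h - (c h + (\<Sum>m\<in>S. g m * c n powi (k - A m) * c (b m) * r ^ (p ^ m)))"
  proof -
    have "c h = (-1) ^ h * coeff (mp \<pi>) (n - h)" by (simp add: c)
    thus ?thesis unfolding c' sum.distrib sum_distrib_left[symmetric] coeff_diff
      by (simp only: algebra_simps)
  qed
  finally show ?thesis
    unfolding cong_mod_max_ideal_iff[OF scaled_valuation_axioms] .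
qed

end
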